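(* Let $\phi:\mathbb{R}^n\to\mathbb{R}^n$ be a bilipschitz $\mathcal{C}^1$ mapping with uniformly continuous Jacobian $J\phi$. Let $A\subset\mathbb{R}^n$ be a measurable set. Then the following are equivalent: (a) $A$ is a smooth set. (b) $\phi^{-1}(A)$ is a smooth set. (c) $A$ satisfies the smoothness condition taking, instead of the grid of cubes, their images through $\phi$, that is, $$\lim_{|Q|\to 0}\ \left(\frac{|A\cap\phi(Q)|}{|\phi(Q)|}-\frac{|A\cap\phi(Q')|}{|\phi(Q')|}\right)=0,$$ where $Q,Q'\subset\mathbb{R}^n$ are consecutive cubes with $l(Q)=l(Q')$ and the limit is uniform over all such pairs (i.e. the supremum of the absolute value of the difference over all pairs of consecutive cubes with $l(Q)=l(Q')\le\delta$ tends to $0$ as $\delta\to 0$).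
   Context: $|\cdot|$ denotes Lebesgue measure of a set in $\mathbb{R}^n$. A cube means a cube in $\mathbb{R}^n$ with sides parallel to the coordinate axes; $l(Q)$ is the sidelength of a cube $Q$. Two cubes $Q,Q'$ with $l(Q)=l(Q')$ are called consecutive if the intersection of their closures is one of their faces. For a measurable set $A\subset\mathbb{R}^n$, the density of $A$ in a cube $Q$ is $D(Q)=|A\cap Q|/|Q|$. A measurable set $A\subset\mathbb{R}^n$ is called smooth (in $\mathbb{R}^n$) if $$\lim_{\delta\to 0}\ \sup|D(Q)-D(Q')|=0,$$ where the supremum is taken over all pairs of consecutive cubes $Q,Q'$ with $l(Q)=l(Q')\le\delta$. A mapping $\phi:\mathbb{R}^n\to\mathbb{R}^n$ is bilipschitz if there is a constant $C\ge 1$ such that $C^{-1}\|x-y\|\le\|\phi(x)-\phi(y)\|\le C\|x-y\|$ for all $x,y\in\mathbb{R}^n$. The Jacobian $J\phi$ is the (scalar) Jacobian determinant of $\phi$, i.e. the determinant of the differential $D\phi$, viewed as a function on $\mathbb{R}^n$. *)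

theory Defs
  imports "HOL-Analysis.Analysis"
begin

text \<open>
  For nonempty sets, \<^const>\<open>is_interval\<close> in \<open>real ^ 'n\<close> means a product of one-dimensional
  intervals, so open, closed and half-open cubes are all covered.
\<close>

definition is_cube :: "real \<Rightarrow> (real ^ 'n) set \<Rightarrow> bool" where
  "is_cube l Q \<longleftrightarrow> 0 < l \<and> is_interval Q \<and> (\<exists>a. closure Q = cbox a (a + vec l))"

text \<open>
  A face of a cube is understood as one of its faces of codimension one, that is, a facet.
\<close>

definition consecutive :: "(real ^ 'n) set \<Rightarrow> (real ^ 'n) set \<Rightarrow> bool" where
  "consecutive Q Q' \<longleftrightarrow>
     (\<exists>l. is_cube l Q \<and> is_cube l Q') \<and>
     (closure Q \<inter> closure Q') facet_of closure Q \<and>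
     (closure Q \<inter> closure Q') facet_of closure Q'"

definition consecutive_pairs :: "real \<Rightarrow> ((real ^ 'n) set \<times> (real ^ 'n) set) set" where
  "consecutive_pairs \<delta> = {(Q, Q'). consecutive Q Q' \<and> (\<exists>l\<le>\<delta>. is_cube l Q \<and> is_cube l Q')}"

definition set_density :: "(real ^ 'n) set \<Rightarrow> (real ^ 'n) set \<Rightarrow> real" where
  "set_density A S = measure lebesgue (A \<inter> S) / measure lebesgue S"

text \<open>
  The real-valued supremum below is a genuine one: densities of measurable sets lie between 0
  and 1, and there are consecutive cubes of every positive sidelength.
\<close>

definition smooth_set :: "(real ^ 'n) set \<Rightarrow> bool" where
  "smooth_set A \<longleftrightarrow>
     A \<in> sets lebesgue \<and>
     ((\<lambda>\<delta>. SUP (Q, Q')\<in>consecutive_pairs \<delta>. \<bar>set_density A Q - set_density A Q'\<bar>)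
        \<longlongrightarrow> 0) (at_right 0)"

definition bilipschitz :: "(real ^ 'n \<Rightarrow> real ^ 'n) \<Rightarrow> bool" where
  "bilipschitz \<phi> \<longleftrightarrow>
     (\<exists>C\<ge>1. \<forall>x y. inverse C * norm (x - y) \<le> norm (\<phi> x - \<phi> y) \<and>
                  norm (\<phi> x - \<phi> y) \<le> C * norm (x - y))"

text \<open>\<^const>\<open>jacobian\<close> is the Jacobian matrix; its determinant is the scalar Jacobian.\<close>

definition C1_map :: "(real ^ 'n \<Rightarrow> real ^ 'n) \<Rightarrow> bool" where
  "C1_map \<phi> \<longleftrightarrow>
     (\<forall>x. \<phi> differentiable (at x)) \<and> continuous_on UNIV (\<lambda>x. jacobian \<phi> (at x))"

definition jacobian_det :: "(real ^ 'n \<Rightarrow> real ^ 'n) \<Rightarrow> real ^ 'n \<Rightarrow> real" where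
  "jacobian_det \<phi> x = det (jacobian \<phi> (at x))"

end

theory Submission
  imports Defs
begin

text \<open>
  Let \<open>\<psi>\<close> be the inverse of \<open>\<phi>\<close>. For every bilipschitz homeomorphism \<open>f\<close>, smoothness of \<open>B\<close> passes to
  the images \<open>f(Q)\<close> of cubes; no Jacobian is needed here. Indeed, divide space into cells of side
  \<open>\<eta> l(Q)\<close>. The cells near \<open>f(Q)\<close> are joined by chains of consecutive cells whose length depends on
  \<open>\<eta>\<close> only, so for small \<open>l(Q)\<close> the set \<open>B\<close> has almost the same density \<open>d\<close> in all of them. The cells
  inside \<open>f(Q)\<close> miss only the image of a thin shell around the boundary of \<open>Q\<close>, a small proportion
  of \<open>f(Q)\<close>. Hence the density of \<open>B\<close> in \<open>f(Q)\<close> is close to \<open>d\<close>, and \<open>d\<close> also serves \<open>Q'\<close>.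

  Uniform continuity of the Jacobian enters only through the fact that the density of \<open>A\<close> in \<open>\<phi>(S)\<close>
  is uniformly close to that of \<open>\<phi>\<^sup>-\<^sup>1(A)\<close> in \<open>S\<close> when \<open>S\<close> has small diameter. With \<open>S = Q\<close> this compares
  (b) with (c). With \<open>S = \<psi>(Q)\<close>, together with the first step for \<open>f = \<psi>\<close> and \<open>B = \<phi>\<^sup>-\<^sup>1(A)\<close>, it
  gives (a) from (b).
\<close>

section \<open>Change of variables for arbitrary finite index types\<close>

text \<open>
  The library proves the change of variables formula for \<open>real ^ 'n\<close> only when \<open>'n\<close> is well-ordered.
  The copy \<open>'n ordered_index\<close> of \<open>'n\<close> is, and a bijection between the two carries the result over.
\<close>

typedef ('n::finite) ordered_index = "{..<CARD('n)}"
  by (rule exI[of _ 0]) simp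

setup_lifting type_definition_ordered_index

instantiation ordered_index :: (finite) wellorder
begin
lift_definition less_eq_ordered_index :: "'a ordered_index \<Rightarrow> 'a ordered_index \<Rightarrow> bool" is "(\<le>)" .
lift_definition less_ordered_index :: "'a ordered_index \<Rightarrow> 'a ordered_index \<Rightarrow> bool" is "(<)" .
instance
proof
  fix P :: "'a ordered_index \<Rightarrow> bool" and a
  assume step: "\<And>x. (\<And>y. y < x \<Longrightarrow> P y) \<Longrightarrow> P x"
  show "P a"
    by (induction a rule: measure_induct_rule[of Rep_ordered_index])
      (rule step, simp only: less_ordered_index.rep_eq)
qed (auto simp: less_eq_ordered_index.rep_eq less_ordered_index.rep_eq Rep_ordered_index_inject)
end

instance ordered_index :: (finite) finite
proof
  show "finite (UNIV :: 'a ordered_index set)"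
    unfolding type_definition.univ[OF type_definition_ordered_index] by simp
qed

lemma ordered_index_bij: "\<exists>\<sigma> :: 'n::finite ordered_index \<Rightarrow> 'n. bij \<sigma>"
proof -
  have "CARD('n ordered_index) = CARD('n)"
    unfolding type_definition.card[OF type_definition_ordered_index] by simp
  then show ?thesis
    by (intro finite_same_card_bij) simp_all
qed

section \<open>Relabelling of coordinates: determinants and Lebesgue measure\<close>

definition reindex :: "('m \<Rightarrow> 'n) \<Rightarrow> 'a ^ 'n \<Rightarrow> 'a ^ 'm" where
  "reindex \<sigma> x = (\<chi> i. x $ \<sigma> i)"

lemma reindex_nth [simp]: "reindex \<sigma> x $ i = x $ \<sigma> i"
  by (simp add: reindex_def)

lemma reindex_inv:
  assumes "bij \<sigma>"
  shows "reindex (inv \<sigma>) (reindex \<sigma> x) = x" "reindex \<sigma> (reindex (inv \<sigma>) y) = y"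
  by (simp_all add: vec_eq_iff inv_f_f[OF bij_is_inj[OF assms]] surj_f_inv_f[OF bij_is_surj[OF assms]])

lemma bounded_linear_reindex: "bounded_linear (reindex \<sigma> :: real ^ 'n \<Rightarrow> real ^ 'm)"
  unfolding linear_conv_bounded_linear[symmetric] by (intro linearI) (auto simp: vec_eq_iff)

text \<open>Conjugation by \<open>\<sigma>\<close> is a sign-preserving bijection between the
  permutations of the two index types, so the Leibniz expansions agree term by term.\<close>

lemma det_reindex:
  fixes A :: "'a::comm_ring_1 ^ 'n ^ 'n" and \<sigma> :: "'m::finite \<Rightarrow> 'n::finite"
  assumes "bij \<sigma>"
  shows "det (\<chi> i j. A $ \<sigma> i $ \<sigma> j) = det A"
proof -
  define \<pi> where "\<pi> p = \<sigma> \<circ> p \<circ> inv \<sigma>" for p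
  define \<pi>' where "\<pi>' p = inv \<sigma> \<circ> p \<circ> \<sigma>" for p
  have inj: "inj \<sigma>" and surj: "surj \<sigma>" using assms by (auto simp: bij_def)
  note inv = inv_f_f[OF inj] surj_f_inv_f[OF surj]
  have map: "map_permutation UNIV \<sigma> p = \<pi> p" if "p permutes UNIV" for p
    unfolding map_permutation_def \<pi>_def using surj by (simp add: restrict_id_def fun_eq_iff)
  have perm: "\<pi> p permutes UNIV" if "p permutes UNIV" for p
    unfolding \<pi>_def
    by (rule bij_imp_permutes[of _ UNIV])
      (simp_all add: bij_comp bij_imp_bij_inv assms permutes_bij[OF that])
  have perm': "\<pi>' p permutes UNIV" if "p permutes UNIV" for p
    unfolding \<pi>'_def
    by (rule bij_imp_permutes[of _ UNIV])
      (simp_all add: bij_comp bij_imp_bij_inv assms permutes_bij[OF that])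
  have sgn: "sign (\<pi> p) = sign p" if "p permutes UNIV" for p
    using sign_map_permutation[OF inj that] map[OF that] by simp
  show ?thesis
    unfolding det_def
  proof (rule sum.reindex_bij_witness[where i = \<pi>' and j = \<pi>])
    fix p :: "'m \<Rightarrow> 'm" assume "p \<in> {p. p permutes UNIV}"
    then have p: "p permutes UNIV" by simp
    have "(\<Prod>i\<in>UNIV. A $ i $ \<pi> p i) = (\<Prod>i\<in>UNIV. A $ \<sigma> i $ \<sigma> (p i))"
      by (rule prod.reindex_bij_witness[where i = \<sigma> and j = "inv \<sigma>"]) (auto simp: \<pi>_def inv)
    then show "of_int (sign (\<pi> p)) * (\<Prod>i\<in>UNIV. A $ i $ \<pi> p i) =
      of_int (sign p) * (\<Prod>i\<in>UNIV. (\<chi> i j. A $ \<sigma> i $ \<sigma> j) $ i $ p i)"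
      by (simp add: sgn[OF p])
  qed (use perm perm' in \<open>auto simp: \<pi>_def \<pi>'_def fun_eq_iff inv\<close>)
qed

text \<open>The preimage of a box is a box with the same side lengths in another order, and values
  on boxes determine \<open>lborel\<close>.\<close>

lemma lborel_reindex:
  fixes \<sigma> :: "'m::finite \<Rightarrow> 'n::finite"
  assumes "bij \<sigma>"
  shows "lborel = distr lborel borel (reindex \<sigma> :: real ^ 'n \<Rightarrow> real ^ 'm)"
proof (rule lborel_eqI)
  fix l u :: "real ^ 'm" assume lu: "\<And>b. b \<in> Basis \<Longrightarrow> l \<bullet> b \<le> u \<bullet> b"
  have le: "l $ i \<le> u $ i" for i
    using lu[of "axis i 1"] by (simp add: cart_eq_inner_axis axis_in_Basis_iff)
  let ?l = "reindex (inv \<sigma>) l" and ?u = "reindex (inv \<sigma>) u"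
  have inj: "inj \<sigma>" and surj: "surj \<sigma>" using assms by (auto simp: bij_def)
  have meas: "(reindex \<sigma> :: real ^ 'n \<Rightarrow> real ^ 'm) \<in> borel \<rightarrow>\<^sub>M borel"
    by (intro borel_measurable_continuous_onI linear_continuous_on bounded_linear_reindex)
  have prod: "(\<Prod>b\<in>Basis. (u - l) \<bullet> b) = (\<Prod>i\<in>UNIV. u $ i - l $ i)" for u l :: "real ^ 'k::finite"
    by (simp add: Basis_vec_def cart_eq_inner_axis axis_eq_axis prod.UNION_disjoint inner_diff_left)
  have pre: "reindex \<sigma> -` box l u = box ?l ?u"
    by (auto simp: mem_box_cart) (metis inv_f_f[OF inj] surj_f_inv_f[OF surj])+
  have "emeasure (distr lborel borel (reindex \<sigma>)) (box l u) = emeasure lborel (box ?l ?u)"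
    using meas by (simp add: emeasure_distr pre)
  also have "\<dots> = (\<Prod>b\<in>Basis. (?u - ?l) \<bullet> b)"
    by (rule emeasure_lborel_box) (auto simp: Basis_vec_def le cart_eq_inner_axis[symmetric])
  also have "(\<Prod>b\<in>Basis. (?u - ?l) \<bullet> b) = (\<Prod>b\<in>Basis. (u - l) \<bullet> b)"
    unfolding prod
    by (rule prod.reindex_bij_witness[where i = \<sigma> and j = "inv \<sigma>"]) (auto simp: inv_f_f[OF inj] surj_f_inv_f[OF surj])
  finally show "emeasure (distr lborel borel (reindex \<sigma>)) (box l u) = (\<Prod>b\<in>Basis. (u - l) \<bullet> b)" .
qed simp

text \<open>Since the pushforward of \<open>lborel\<close> is \<open>lborel\<close>, preimages of
  null sets are null; this carries measurability and the equality over to the completions.\<close>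

lemma
  fixes \<sigma> :: "'m::finite \<Rightarrow> 'n::finite"
  assumes "bij \<sigma>"
  shows measurable_lebesgue_reindex: "(reindex \<sigma> :: real ^ 'n \<Rightarrow> real ^ 'm) \<in> lebesgue \<rightarrow>\<^sub>M lebesgue"
    and lebesgue_reindex: "lebesgue = distr lebesgue lebesgue (reindex \<sigma> :: real ^ 'n \<Rightarrow> real ^ 'm)"
proof -
  let ?T = "reindex \<sigma> :: real ^ 'n \<Rightarrow> real ^ 'm"
  have T: "?T \<in> borel \<rightarrow>\<^sub>M borel"
    by (intro borel_measurable_continuous_onI linear_continuous_on bounded_linear_reindex)
  have d: "distr lebesgue lborel ?T = lborel"
    using T lborel_reindex[OF assms] by (simp add: distr_completion cong: distr_cong)
  show "?T \<in> lebesgue \<rightarrow>\<^sub>M lebesgue"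
    using T by (intro completion.measurable_completion2) (simp_all add: d measurable_completion)
  have "completion (distr lebesgue lborel ?T) = distr lebesgue (completion lborel) ?T"
    using T by (intro completion.completion_distr_eq) (simp_all add: d measurable_completion)
  then show "lebesgue = distr lebesgue lebesgue ?T" by (simp add: d)
qed

lemma reindex_image_eq_vimage:
  "bij \<sigma> \<Longrightarrow> reindex \<sigma> ` S = reindex (inv \<sigma>) -` S"
  by (auto simp: reindex_inv image_iff intro!: bexI[where x = "reindex (inv \<sigma>) x" for x])

lemma
  fixes \<sigma> :: "'m::finite \<Rightarrow> 'n::finite" and S :: "(real ^ 'n) set"
  assumes "bij \<sigma>" "S \<in> lmeasurable"
  shows lmeasurable_reindex: "reindex \<sigma> ` S \<in> lmeasurable"
    and measure_reindex: "measure lebesgue (reindex \<sigma> ` S) = measure lebesgue S"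
proof -
  let ?R = "reindex (inv \<sigma>) :: real ^ 'm \<Rightarrow> real ^ 'n"
  have b: "bij (inv \<sigma>)" using assms(1) by (rule bij_imp_bij_inv)
  have S: "S \<in> sets lebesgue" using assms(2) by auto
  have sets: "reindex \<sigma> ` S \<in> sets lebesgue"
    unfolding reindex_image_eq_vimage[OF assms(1)]
    using measurable_sets[OF measurable_lebesgue_reindex[OF b] S] by simp
  have em: "emeasure lebesgue (reindex \<sigma> ` S) = emeasure lebesgue S"
    unfolding reindex_image_eq_vimage[OF assms(1)]
    using emeasure_distr[OF measurable_lebesgue_reindex[OF b] S] lebesgue_reindex[OF b] by simp
  show "reindex \<sigma> ` S \<in> lmeasurable"
    using sets em assms(2) by (auto simp: fmeasurable_def)
  show "measure lebesgue (reindex \<sigma> ` S) = measure lebesgue S"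
    by (simp add: measure_def em)
qed

section \<open>Distortion of measure from bounds on the Jacobian\<close>

lemma measure_differentiable_image_bounds_wellorder:
  fixes f :: "real ^ 'n::{finite,wellorder} \<Rightarrow> real ^ 'n::_"
  assumes S: "S \<in> lmeasurable"
    and f: "\<And>x. x \<in> S \<Longrightarrow> (f has_derivative f' x) (at x within S)" and inj: "inj_on f S"
    and lo: "\<And>x. x \<in> S \<Longrightarrow> lo \<le> \<bar>det (matrix (f' x))\<bar>"
    and hi: "\<And>x. x \<in> S \<Longrightarrow> \<bar>det (matrix (f' x))\<bar> \<le> hi"
  shows "f ` S \<in> lmeasurable \<and> lo * measure lebesgue S \<le> measure lebesgue (f ` S)
    \<and> measure lebesgue (f ` S) \<le> hi * measure lebesgue S"
proof -
  let ?d = "\<lambda>x. \<bar>det (matrix (f' x))\<bar>"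
  have S': "S \<in> sets lebesgue" using S by auto
  have c: "(\<lambda>x. k) integrable_on S" "integral S (\<lambda>x. k) = k * measure lebesgue S" for k :: real
    using S by (simp_all add: integrable_on_const lmeasure_integral flip: integral_mult_right)
  \<comment> \<open>The measure of the image is the integral of the absolute Jacobian. This
    integrand is measurable and bounded by \<open>hi\<close> on a set of finite measure, hence
    integrable.\<close>
  have "(\<lambda>x. det (matrix (f' x))) \<in> borel_measurable (lebesgue_on S)"
    by (rule borel_measurable_det_Jacobian[OF S' f])
  then have int: "?d integrable_on S"
    using hi S' by (intro measurable_bounded_by_integrable_imp_integrable[OF _ c(1)[of hi]]) (simp_all add: borel_measurable_abs)
  have "f ` S \<in> lmeasurable" "measure lebesgue (f ` S) = integral S ?d"
    using measurable_differentiable_image_eq[OF S' f inj] measure_differentiable_image_eq[OF S' f inj int] int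
    by auto
  moreover have "lo * measure lebesgue S \<le> integral S ?d"
    using integral_le[OF c(1) int, of lo] lo by (simp add: c)
  moreover have "integral S ?d \<le> hi * measure lebesgue S"
    using integral_le[OF int c(1), of hi] hi by (simp add: c)
  ultimately show ?thesis by auto
qed

text \<open>Conjugation by a relabelling moves \<open>f\<close> to a well-ordered index type. It
  permutes rows and columns of the derivative matrix in the same way, so determinants and measures
  are unchanged and the bounds carry over.\<close>

lemma measure_differentiable_image_bounds:
  fixes f :: "real ^ 'n \<Rightarrow> real ^ 'n"
  assumes S: "S \<in> lmeasurable"
    and f: "\<And>x. x \<in> S \<Longrightarrow> (f has_derivative f' x) (at x within S)" and inj: "inj_on f S"
    and lo: "\<And>x. x \<in> S \<Longrightarrow> lo \<le> \<bar>det (matrix (f' x))\<bar>"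
    and hi: "\<And>x. x \<in> S \<Longrightarrow> \<bar>det (matrix (f' x))\<bar> \<le> hi"
  shows "f ` S \<in> lmeasurable" "lo * measure lebesgue S \<le> measure lebesgue (f ` S)"
    "measure lebesgue (f ` S) \<le> hi * measure lebesgue S"
proof -
  obtain \<sigma> :: "'n ordered_index \<Rightarrow> 'n" where \<sigma>: "bij \<sigma>" using ordered_index_bij by blast
  have \<sigma>': "bij (inv \<sigma>)" using \<sigma> by (rule bij_imp_bij_inv)
  let ?T = "reindex \<sigma> :: real ^ 'n \<Rightarrow> real ^ 'n ordered_index"
  let ?R = "reindex (inv \<sigma>) :: real ^ 'n ordered_index \<Rightarrow> real ^ 'n"
  note [simp] = reindex_inv[OF \<sigma>]
  define h where "h = ?T \<circ> f \<circ> ?R"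
  define h' where "h' y = ?T \<circ> f' (?R y) \<circ> ?R" for y
  have RT: "?R ` ?T ` S = S" by (simp add: image_image)
  have det: "det (matrix (h' y)) = det (matrix (f' (?R y)))" if "y \<in> ?T ` S" for y
  proof -
    have "?R (axis j 1) = axis (\<sigma> j) 1" for j
      by (auto simp: vec_eq_iff axis_def inv_f_f[OF bij_is_inj[OF \<sigma>]] surj_f_inv_f[OF bij_is_surj[OF \<sigma>]])
    then have "matrix (h' y) = (\<chi> i j. matrix (f' (?R y)) $ \<sigma> i $ \<sigma> j)"
      by (simp add: matrix_def h'_def)
    then show ?thesis using det_reindex[OF \<sigma>] by metis
  qed
  have deriv: "(h has_derivative h' y) (at y within ?T ` S)" if y: "y \<in> ?T ` S" for y
  proof -
    have 1: "(?R has_derivative ?R) (at y within ?T ` S)"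
      by (rule bounded_linear_imp_has_derivative[OF bounded_linear_reindex])
    have "?R y \<in> S" using y by auto
    then have 2: "(f has_derivative f' (?R y)) (at (?R y) within ?R ` ?T ` S)"
      unfolding RT by (rule f)
    have 3: "(?T has_derivative ?T) (at ((f \<circ> ?R) y) within Z)" for Z
      by (rule bounded_linear_imp_has_derivative[OF bounded_linear_reindex])
    show ?thesis
      unfolding h_def h'_def comp_assoc
      using diff_chain_within[OF diff_chain_within[OF 1 2] 3]
      by (simp add: o_def)
  qed
  have injh: "inj_on h (?T ` S)"
  proof (rule inj_onI)
    fix y y' assume y: "y \<in> ?T ` S" "y' \<in> ?T ` S" "h y = h y'"
    then have "?R (h y) = ?R (h y')" by simp
    then have "f (?R y) = f (?R y')" by (simp add: h_def)
    moreover have "?R y \<in> S" "?R y' \<in> S" using y(1,2) by auto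
    ultimately have "?R y = ?R y'" by (rule inj_onD[OF inj])
    then have "?T (?R y) = ?T (?R y')" by (rule arg_cong)
    then show "y = y'" by simp
  qed
  have TS: "?T ` S \<in> lmeasurable" by (rule lmeasurable_reindex[OF \<sigma> S])
  have *: "h ` ?T ` S \<in> lmeasurable \<and> lo * measure lebesgue (?T ` S) \<le> measure lebesgue (h ` ?T ` S)
    \<and> measure lebesgue (h ` ?T ` S) \<le> hi * measure lebesgue (?T ` S)"
    by (rule measure_differentiable_image_bounds_wellorder[OF TS deriv injh]) (use lo hi in \<open>auto simp: det\<close>)
  have eq: "h ` ?T ` S = ?T ` f ` S" by (simp add: h_def image_image)
  have fS: "f ` S = ?R ` h ` ?T ` S" unfolding eq by (simp add: image_image)
  show "f ` S \<in> lmeasurable" unfolding fS using lmeasurable_reindex[OF \<sigma>'] * by blast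
  have "measure lebesgue (f ` S) = measure lebesgue (h ` ?T ` S)"
    unfolding fS using measure_reindex[OF \<sigma>'] * by blast
  then show "lo * measure lebesgue S \<le> measure lebesgue (f ` S)"
    "measure lebesgue (f ` S) \<le> hi * measure lebesgue S"
    using * measure_reindex[OF \<sigma> S] by auto
qed

section \<open>Bilipschitz maps\<close>

text \<open>A Lipschitz map is continuous and sends negligible sets to negligible sets; together
  these properties preserve Lebesgue measurability of images.\<close>

lemma sets_lebesgue_lipschitz_image:
  fixes f :: "'a::euclidean_space \<Rightarrow> 'a"
  assumes lip: "C-lipschitz_on UNIV f" and S: "S \<in> sets lebesgue"
  shows "f ` S \<in> sets lebesgue"
proof (rule sets_lebesgue_continuous_image[OF S, of UNIV])
  show "continuous_on UNIV f" using lip by (rule lipschitz_on_continuous_on)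
  show "negligible (f ` T)" if "negligible T" for T
  proof (rule negligible_locally_Lipschitz_image[OF _ that])
    show "\<exists>U B. open U \<and> x \<in> U \<and> (\<forall>y\<in>T \<inter> U. norm (f y - f x) \<le> B * norm (y - x))" for x
      using lipschitz_onD[OF lip] by (intro exI[of _ UNIV] exI[of _ C]) (simp add: dist_norm)
  qed simp
qed simp

text \<open>Surjectivity is a connectedness argument: the range is open by invariance of domain, and
  closed because the lower bound makes the preimages of a convergent sequence a Cauchy
  sequence.\<close>

lemma bilipschitz_bij:
  fixes f :: "'a::euclidean_space \<Rightarrow> 'a"
  assumes C: "0 < C" and lo: "\<And>x y. norm (x - y) \<le> C * norm (f x - f y)"
    and lip: "\<And>x y. norm (f x - f y) \<le> C * norm (x - y)"
  shows "bij f"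
proof -
  have inj: "inj f"
  proof (rule injI)
    fix x y assume "f x = f y"
    then show "x = y" using lo[of x y] by simp
  qed
  have "C-lipschitz_on UNIV f" using C lip by (auto simp: lipschitz_on_def dist_norm)
  then have cont: "continuous_on UNIV f" by (rule lipschitz_on_continuous_on)
  have "open (range f)" using inj cont by (intro invariance_of_domain_gen) auto
  moreover have "closed (range f)"
    unfolding closed_sequential_limits
  proof (intro allI impI)
    fix u l assume *: "(\<forall>n. u n \<in> range f) \<and> u \<longlonglongrightarrow> l"
    then have "\<forall>n. \<exists>x. u n = f x" by blast
    then obtain v where v: "\<And>n. u n = f (v n)" by metis
    have "Cauchy v"
      unfolding Cauchy_def
    proof (intro allI impI)
      fix e :: real assume "0 < e"
      then have "0 < e / C" using C by simp
      moreover have "Cauchy u" using * LIMSEQ_imp_Cauchy by blast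
      ultimately obtain N where N: "\<And>m n. m \<ge> N \<Longrightarrow> n \<ge> N \<Longrightarrow> dist (u m) (u n) < e / C"
        using metric_CauchyD[of u "e / C"] by metis
      have "dist (v m) (v n) < e" if "m \<ge> N" "n \<ge> N" for m n
      proof -
        have "dist (v m) (v n) \<le> C * dist (u m) (u n)" using lo by (simp add: v dist_norm)
        also have "\<dots> < C * (e / C)" using N[OF that] C by (rule mult_strict_left_mono)
        finally show ?thesis using C by simp
      qed
      then show "\<exists>N. \<forall>m\<ge>N. \<forall>n\<ge>N. dist (v m) (v n) < e" by blast
    qed
    then obtain z where "v \<longlonglongrightarrow> z" using Cauchy_convergent convergent_def by blast
    then have "(\<lambda>n. f (v n)) \<longlonglongrightarrow> f z"
      by (rule continuous_on_tendsto_compose[OF cont]) auto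
    then have "u \<longlonglongrightarrow> f z" unfolding v[symmetric] .
    then have "l = f z" using * by (blast intro: LIMSEQ_unique)
    then show "l \<in> range f" by simp
  qed
  ultimately have "range f = UNIV" using clopen[of "range f"] by auto
  with inj show ?thesis by (simp add: bij_def)
qed

section \<open>Derivative and Jacobian bounds for bilipschitz maps\<close>

lemma abs_det_le:
  fixes A :: "real ^ 'n ^ 'n"
  assumes "\<And>i j. \<bar>A $ i $ j\<bar> \<le> C"
  shows "\<bar>det A\<bar> \<le> fact CARD('n) * C ^ CARD('n)"
proof -
  have "\<bar>det A\<bar> \<le> (\<Sum>p | p permutes (UNIV :: 'n set). \<bar>of_int (sign p) * (\<Prod>i\<in>UNIV. A $ i $ p i)\<bar>)"
    unfolding det_def by (rule sum_abs)
  also have "\<dots> \<le> (\<Sum>p | p permutes (UNIV :: 'n set). C ^ CARD('n))"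
  proof (rule sum_mono)
    fix p :: "'n \<Rightarrow> 'n"
    have "\<bar>\<Prod>i\<in>UNIV. A $ i $ p i\<bar> \<le> (\<Prod>i\<in>(UNIV :: 'n set). C)"
      unfolding abs_prod by (intro prod_mono) (use assms in auto)
    then show "\<bar>of_int (sign p) * (\<Prod>i\<in>UNIV. A $ i $ p i)\<bar> \<le> C ^ CARD('n)"
      by (simp add: abs_mult sign_def)
  qed
  also have "\<dots> = fact CARD('n) * C ^ CARD('n)"
    by (simp add: card_permutations[of UNIV])
  finally show ?thesis .
qed

text \<open>A difference quotient in direction \<open>v\<close> satisfies both bounds exactly and
  approximates \<open>f' v\<close>; the bounds survive the limit.\<close>

lemma has_derivative_bilipschitz_bounds:
  fixes f :: "'a::real_normed_vector \<Rightarrow> 'b::real_normed_vector"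
  assumes f: "(f has_derivative f') (at x)"
    and lo: "\<And>x y. c * norm (x - y) \<le> norm (f x - f y)"
    and hi: "\<And>x y. norm (f x - f y) \<le> C * norm (x - y)"
  shows "c * norm v \<le> norm (f' v)" "norm (f' v) \<le> C * norm v"
proof -
  have lin: "linear f'" using f by (rule has_derivative_linear)
  have "\<exists>w. norm (w - f' v) \<le> e * norm v \<and> c * norm v \<le> norm w \<and> norm w \<le> C * norm v" if "e > 0" for e
  proof (cases "v = 0")
    case True
    then show ?thesis using linear_0[OF lin] by auto
  next
    case False
    obtain d where "d > 0" and d: "\<And>y. norm (y - x) < d \<Longrightarrow> norm (f y - f x - f' (y - x)) \<le> e * norm (y - x)"
      using f \<open>e > 0\<close> unfolding has_derivative_at_alt by metis
    define t where "t = d / (2 * norm v)"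
    have t: "t > 0" "t * norm v < d" using \<open>d > 0\<close> False by (auto simp: t_def)
    define w where "w = (1 / t) *\<^sub>R (f (x + t *\<^sub>R v) - f x)"
    have w: "f (x + t *\<^sub>R v) - f x = t *\<^sub>R w" using t by (simp add: w_def)
    have "norm (t *\<^sub>R w - t *\<^sub>R f' v) \<le> e * (t * norm v)"
      using d[of "x + t *\<^sub>R v"] t by (simp add: w linear_cmul[OF lin])
    then have "t * norm (w - f' v) \<le> t * (e * norm v)"
      using t by (simp flip: scaleR_diff_right add: mult_ac)
    moreover have "t * (c * norm v) \<le> t * norm w" "t * norm w \<le> t * (C * norm v)"
      using lo[of "x + t *\<^sub>R v" x] hi[of "x + t *\<^sub>R v" x] t by (simp_all add: w mult_ac)
    ultimately show ?thesis using t(1) by (intro exI[of _ w]) (simp add: mult_le_cancel_left_pos)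
  qed
  then have e: "c * norm v \<le> norm (f' v) + e * norm v \<and> norm (f' v) \<le> C * norm v + e * norm v" if "e > 0" for e
    using that by (smt (verit) norm_triangle_ineq2 norm_minus_commute)
  \<comment> \<open>Dividing by \<open>norm v + 1\<close> turns the error \<open>e * norm v\<close>
    into at most \<open>e\<close>, and is safe at \<open>v = 0\<close>.\<close>
  have e': "c * norm v \<le> norm (f' v) + e \<and> norm (f' v) \<le> C * norm v + e" if "e > 0" for e
  proof -
    have "e / (norm v + 1) * norm v \<le> e"
      using \<open>e > 0\<close> by (simp add: pos_divide_le_eq add_nonneg_pos distrib_left)
    moreover have "e / (norm v + 1) > 0" using \<open>e > 0\<close> by (simp add: add_nonneg_pos)
    ultimately show ?thesis using e[of "e / (norm v + 1)"] by linarith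
  qed
  show "c * norm v \<le> norm (f' v)" "norm (f' v) \<le> C * norm v"
    using e' by (auto intro: field_le_epsilon)
qed

text \<open>Entries of a matrix are bounded by the lengths of its columns. The lower bound makes
  \<open>A\<close> invertible, with an inverse \<open>B\<close> obeying the same entry bound, so
  \<open>det A * det B = 1\<close> turns the upper bound for \<open>B\<close> into a lower bound for
  \<open>A\<close>.\<close>

lemma abs_det_bilipschitz_bounds:
  fixes A :: "real ^ 'n ^ 'n"
  assumes C: "0 < C" and lo: "\<And>v. norm v \<le> C * norm (A *v v)" and hi: "\<And>v. norm (A *v v) \<le> C * norm v"
  defines "M \<equiv> fact CARD('n) * C ^ CARD('n)"
  shows "\<bar>det A\<bar> \<le> M" "1 / M \<le> \<bar>det A\<bar>"
proof -
  have entry: "\<bar>B $ i $ j\<bar> \<le> norm (B *v axis j 1)" for B :: "real ^ 'n ^ 'n" and i j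
    using component_le_norm_cart[of "B *v axis j 1" i] by (simp add: matrix_vector_mul_component inner_axis)
  have "\<bar>A $ i $ j\<bar> \<le> C" for i j
    using entry[of A i j] hi[of "axis j 1"] by simp
  then show "\<bar>det A\<bar> \<le> M" unfolding M_def by (rule abs_det_le)
  have "A *v x = 0 \<Longrightarrow> x = 0" for x
    using lo[of x] by simp
  then obtain B where B: "B ** A = mat 1" using matrix_left_invertible_ker[of A] by auto
  then have AB: "A ** B = mat 1" by (simp add: matrix_left_right_inverse)
  have "\<bar>B $ i $ j\<bar> \<le> C" for i j
    using entry[of B i j] lo[of "B *v axis j 1"] by (simp add: matrix_vector_mul_assoc AB)
  then have "\<bar>det B\<bar> \<le> M" unfolding M_def by (rule abs_det_le)
  moreover have "\<bar>det A\<bar> * \<bar>det B\<bar> = 1"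
    using arg_cong[OF AB, of det] by (simp add: det_mul flip: abs_mult)
  moreover have "M > 0" unfolding M_def using C by simp
  ultimately show "1 / M \<le> \<bar>det A\<bar>"
    by (metis abs_ge_zero divide_le_eq mult_left_mono)
qed

text \<open>
  The assumptions are symmetric in \<open>f\<close> and \<open>g\<close>, and the distortion of measure is assumed rather than
  derived from a derivative, so that the inverse map can take the role of \<open>f\<close> without being shown to
  be differentiable.
\<close>

locale bilipschitz_homeo =
  fixes f g :: "real ^ 'n \<Rightarrow> real ^ 'n" and C M :: real
  assumes gf [simp]: "g (f x) = x" and fg [simp]: "f (g y) = y"
    and C: "1 \<le> C"
    and lip_f: "norm (f x - f y) \<le> C * norm (x - y)"
    and lip_g: "norm (g x - g y) \<le> C * norm (x - y)"
    and M: "0 < M"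
    and measure_f: "bounded S \<Longrightarrow> S \<in> sets lebesgue \<Longrightarrow> measure lebesgue (f ` S) \<le> M * measure lebesgue S"
    and measure_g: "bounded S \<Longrightarrow> S \<in> sets lebesgue \<Longrightarrow> measure lebesgue (g ` S) \<le> M * measure lebesgue S"
begin

lemma inverse: "bilipschitz_homeo g f C M"
  using gf fg C lip_f lip_g M measure_f measure_g by unfold_locales

lemma lipschitz_f: "C-lipschitz_on S f"
  using C lip_f by (auto simp: lipschitz_on_def dist_norm)

lemma sets_f: "S \<in> sets lebesgue \<Longrightarrow> f ` S \<in> sets lebesgue"
  using lipschitz_f by (rule sets_lebesgue_lipschitz_image)

lemma bounded_f: "bounded S \<Longrightarrow> bounded (f ` S)"
  by (rule bounded_uniformly_continuous_image[OF lipschitz_on_uniformly_continuous[OF lipschitz_f]])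

lemma measure_f_ge:
  assumes "bounded S" "S \<in> sets lebesgue"
  shows "measure lebesgue S \<le> M * measure lebesgue (f ` S)"
  using measure_g[OF bounded_f sets_f, OF assms] by (simp add: image_image)

lemma vimage_f: "f -` S = g ` S"
  by (auto simp: image_iff) (metis gf)

end

lemma bilipschitz_C1_homeo:
  fixes \<phi> :: "real ^ 'n \<Rightarrow> real ^ 'n"
  assumes "bilipschitz \<phi>" "C1_map \<phi>"
  obtains \<psi> C M where "bilipschitz_homeo \<phi> \<psi> C M"
proof -
  obtain C where C: "1 \<le> C" and lo0: "\<And>x y. inverse C * norm (x - y) \<le> norm (\<phi> x - \<phi> y)"
    and hi: "\<And>x y. norm (\<phi> x - \<phi> y) \<le> C * norm (x - y)"
    using assms(1) unfolding bilipschitz_def by blast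
  have C0: "0 < C" using C by simp
  have lo: "norm (x - y) \<le> C * norm (\<phi> x - \<phi> y)" for x y
    using lo0[of x y] C0 by (simp add: field_simps)
  have bij: "bij \<phi>" using C0 lo hi by (rule bilipschitz_bij)
  define \<psi> where "\<psi> = inv \<phi>"
  have \<psi>\<phi>: "\<psi> (\<phi> x) = x" and \<phi>\<psi>: "\<phi> (\<psi> x) = x" for x
    using bij by (simp_all add: \<psi>_def bij_is_inj bij_is_surj surj_f_inv_f)
  define M where "M = fact CARD('n) * C ^ CARD('n)"
  have M: "0 < M" using C0 by (simp add: M_def)
  have deriv: "(\<phi> has_derivative (\<lambda>v. jacobian \<phi> (at x) *v v)) (at x)" for x
    using assms(2) jacobian_works[of \<phi> "at x"] by (simp add: C1_map_def)
  have J: "\<bar>jacobian_det \<phi> x\<bar> \<le> M" "1 / M \<le> \<bar>jacobian_det \<phi> x\<bar>" for x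
  proof -
    have b: "inverse C * norm v \<le> norm (jacobian \<phi> (at x) *v v)"
      "norm (jacobian \<phi> (at x) *v v) \<le> C * norm v" for v
      using has_derivative_bilipschitz_bounds[OF deriv lo0 hi] by blast+
    have "norm v \<le> C * norm (jacobian \<phi> (at x) *v v)" for v
      using b(1)[of v] C0 by (simp add: field_simps)
    then show "\<bar>jacobian_det \<phi> x\<bar> \<le> M" "1 / M \<le> \<bar>jacobian_det \<phi> x\<bar>"
      unfolding M_def jacobian_det_def by (blast intro: abs_det_bilipschitz_bounds[OF C0 _ b(2)])+
  qed
  have meas: "1 / M * measure lebesgue S \<le> measure lebesgue (\<phi> ` S)"
    "measure lebesgue (\<phi> ` S) \<le> M * measure lebesgue S" if "bounded S" "S \<in> sets lebesgue" for S
    using measure_differentiable_image_bounds(2,3)[OF bounded_set_imp_lmeasurable[OF that]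
        has_derivative_at_withinI[OF deriv] inj_on_subset[OF bij_is_inj[OF bij] subset_UNIV], of "1 / M" M]
      J by (simp_all add: jacobian_det_def)
  have lip_\<psi>: "norm (\<psi> x - \<psi> y) \<le> C * norm (x - y)" for x y
    using lo[of "\<psi> x" "\<psi> y"] by (simp add: \<phi>\<psi>)
  have "bilipschitz_homeo \<phi> \<psi> C M"
  proof
    fix S :: "(real ^ 'n) set" assume S: "bounded S" "S \<in> sets lebesgue"
    have lip: "C-lipschitz_on UNIV \<psi>" using C lip_\<psi> by (auto simp: lipschitz_on_def dist_norm)
    have b: "bounded (\<psi> ` S)"
      using S(1) bounded_uniformly_continuous_image[OF lipschitz_on_uniformly_continuous[OF lipschitz_on_subset[OF lip subset_UNIV]]]
      by blast
    \<comment> \<open>Since \<phi> maps \<psi>(S) onto S, the lower estimate for \<phi> on \<psi>(S)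
      is the upper estimate wanted for \<psi>.\<close>
    have "1 / M * measure lebesgue (\<psi> ` S) \<le> measure lebesgue (\<phi> ` \<psi> ` S)"
      using b sets_lebesgue_lipschitz_image[OF lip S(2)] by (rule meas(1))
    then show "measure lebesgue (\<psi> ` S) \<le> M * measure lebesgue S"
      using M by (simp add: image_image \<phi>\<psi> field_simps)
  qed (use \<psi>\<phi> \<phi>\<psi> C hi lip_\<psi> M meas(2) in auto)
  then show thesis by (rule that)
qed

section \<open>Cubes and grids\<close>

text \<open>By convexity the interior of \<open>Q\<close> is that of its closure, and its frontier
  is negligible; so the choice of boundary points in \<open>Q\<close> does not affect the
  measure.\<close>

lemma
  fixes Q :: "(real ^ 'n) set"
  assumes "is_cube l Q" and cl: "closure Q = cbox a (a + vec l)"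
  shows cube_subset: "Q \<subseteq> cbox a (a + vec l)" and cube_superset: "box a (a + vec l) \<subseteq> Q"
    and bounded_cube: "bounded Q" and lmeasurable_cube: "Q \<in> lmeasurable"
    and measure_cube: "measure lebesgue Q = l ^ CARD('n)"
proof -
  have l: "0 < l" and Q: "convex Q" using assms is_interval_convex by (auto simp: is_cube_def)
  show sub: "Q \<subseteq> cbox a (a + vec l)" using cl closure_subset by metis
  have "interior Q = box a (a + vec l)"
    using convex_interior_closure[OF Q] cl by (simp add: interior_cbox)
  then show "box a (a + vec l) \<subseteq> Q" using interior_subset by metis
  show b: "bounded Q" using sub bounded_cbox bounded_subset by blast
  show "Q \<in> lmeasurable" using Q b by (rule measurable_convex)
  have "measure lebesgue Q = measure lborel (cbox a (a + vec l))"
    using measure_closure[OF b negligible_convex_frontier[OF Q]] cl by simp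
  also have "\<dots> = l ^ CARD('n)"
    using l by (subst content_cbox_cart) (auto simp: interval_ne_empty_cart)
  finally show "measure lebesgue Q = l ^ CARD('n)" .
qed

lemma norm_le_card_mult:
  fixes x :: "real ^ 'n"
  assumes "\<And>i. \<bar>x $ i\<bar> \<le> r"
  shows "norm x \<le> real CARD('n) * r"
  using norm_le_l1_cart[of x] sum_mono[of UNIV "\<lambda>i. \<bar>x $ i\<bar>" "\<lambda>i. r"] assms by simp

section \<open>The grid of half-open cells\<close>

text \<open>Half-open cells are pairwise disjoint and cover the space, so measures of unions of
  cells add up without boundary corrections.\<close>

definition cell :: "real \<Rightarrow> ('n \<Rightarrow> int) \<Rightarrow> (real ^ 'n) set" where
  "cell s z = {x. \<forall>i. s * z i \<le> x $ i \<and> x $ i < s * (z i + 1)}"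

lemma mem_cell_floor: "0 < s \<Longrightarrow> y \<in> cell s (\<lambda>i. \<lfloor>y $ i / s\<rfloor>)"
proof -
  assume s: "0 < s"
  have "s * \<lfloor>y $ i / s\<rfloor> \<le> y $ i" "y $ i < s * (\<lfloor>y $ i / s\<rfloor> + 1)" for i
    using s mult_left_mono[of "\<lfloor>y $ i / s\<rfloor>" "y $ i / s" s]
      mult_strict_left_mono[of "y $ i / s" "\<lfloor>y $ i / s\<rfloor> + 1" s] floor_correct[of "y $ i / s"]
    by simp_all
  then show ?thesis by (simp add: cell_def)
qed

lemma corner_in_cell: "0 < s \<Longrightarrow> (\<chi> i. s * z i) \<in> cell s z"
  by (simp add: cell_def)

lemma dist_cell:
  fixes x y :: "real ^ 'n" and s :: real
  assumes "x \<in> cell s z" "y \<in> cell s z"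
  shows "norm (x - y) \<le> real CARD('n) * s"
proof (rule norm_le_card_mult)
  fix i
  have "s * z i \<le> x $ i" "x $ i < s * z i + s" "s * z i \<le> y $ i" "y $ i < s * z i + s"
    using assms by (auto simp: cell_def algebra_simps)
  then show "\<bar>(x - y) $ i\<bar> \<le> s" by simp
qed

text \<open>The bound is scale invariant: for points at distance comparable to \<open>s\<close>, the
  number of steps between their cells is bounded independently of \<open>s\<close>.\<close>

lemma cell_index_distance:
  assumes s: "0 < s" and x: "x \<in> cell s z" and y: "y \<in> cell s w"
  shows "\<bar>z i - w i\<bar> \<le> norm (x - y) / s + 1"
proof -
  have "s * z i \<le> x $ i" "x $ i < s * z i + s" "s * w i \<le> y $ i" "y $ i < s * w i + s"
    using x y by (auto simp: cell_def algebra_simps)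
  moreover have "\<bar>x $ i - y $ i\<bar> \<le> norm (x - y)"
    using component_le_norm_cart[of "x - y" i] by simp
  ultimately have "s * z i - s * w i \<le> norm (x - y) + s" "s * w i - s * z i \<le> norm (x - y) + s"
    by linarith+
  then have "s * \<bar>z i - w i\<bar> \<le> norm (x - y) + s"
    using s by (auto simp: abs_if algebra_simps)
  then show ?thesis using s by (simp add: field_simps)
qed

lemma disjoint_cells:
  assumes s: "0 < s" and "x \<in> cell s z" "x \<in> cell s w"
  shows "z = w"
proof
  fix i
  have "s * z i < s * (w i + 1)" "s * w i < s * (z i + 1)"
    using assms(2,3) by (auto simp: cell_def intro: le_less_trans)
  then have "real_of_int (z i) < real_of_int (w i) + 1" "real_of_int (w i) < real_of_int (z i) + 1"
    using s by (simp_all add: mult_less_cancel_left_pos)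
  then show "z i = w i" by linarith
qed

text \<open>Each such cell has its lower corner in the bounded set, which confines every integer
  coordinate to a fixed interval.\<close>

lemma finite_cells:
  fixes V :: "(real ^ 'n) set"
  assumes s: "0 < s" and V: "bounded V"
  shows "finite {z. cell s z \<subseteq> V}"
proof -
  obtain b where b: "\<And>x. x \<in> V \<Longrightarrow> norm x \<le> b" using V bounded_iff by blast
  define k where "k = \<lceil>b / s\<rceil>"
  have "{z :: 'n \<Rightarrow> int. cell s z \<subseteq> V} \<subseteq> (\<Pi>\<^sub>E i\<in>UNIV. {-k..k})"
  proof (rule subsetI, rule PiE_I)
    fix z :: "'n \<Rightarrow> int" and i assume "z \<in> {z. cell s z \<subseteq> V}"
    then have "cell s z \<subseteq> V" by simp
    then have "norm (\<chi> i. s * z i) \<le> b" using corner_in_cell[OF s, of z] b by blast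
    then have "\<bar>s * z i\<bar> \<le> b" using component_le_norm_cart[of "\<chi> i. s * z i" i] by simp
    then have "s * \<bar>z i\<bar> \<le> b" using s by (simp add: abs_mult)
    then have "\<bar>z i\<bar> \<le> b / s" using s by (simp add: field_simps)
    then have "\<bar>z i\<bar> \<le> k" unfolding k_def by linarith
    then have "- k \<le> z i" "z i \<le> k" by linarith+
    then show "z i \<in> {-k..k}" by simp
  qed simp
  then show ?thesis by (rule finite_subset) (intro finite_PiE; simp)
qed

lemma closure_cell:
  assumes "0 < s"
  shows "closure (cell s z) = cbox (\<chi> i. s * z i) ((\<chi> i. s * z i) + vec s)"
proof -
  let ?a = "\<chi> i. s * z i"
  have "x \<in> cell s z" if "x \<in> box ?a (?a + vec s)" for x
  proof -
    have "s * z i < x $ i \<and> x $ i < s * z i + s" for i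
      using that unfolding mem_box_cart by simp
    then show ?thesis by (simp add: cell_def distrib_left less_imp_le)
  qed
  moreover have "x \<in> cbox ?a (?a + vec s)" if "x \<in> cell s z" for x
  proof -
    have "s * z i \<le> x $ i \<and> x $ i < s * z i + s" for i
      using that unfolding cell_def by (simp add: distrib_left)
    then show ?thesis unfolding mem_box_cart by (simp add: less_imp_le)
  qed
  ultimately have sub: "box ?a (?a + vec s) \<subseteq> cell s z" "cell s z \<subseteq> cbox ?a (?a + vec s)"
    by blast+
  have "box ?a (?a + vec s) \<noteq> {}" using assms by (simp add: interval_ne_empty_cart)
  then have "cbox ?a (?a + vec s) \<subseteq> closure (cell s z)"
    using closure_mono[OF sub(1)] by simp
  with closure_minimal[OF sub(2) closed_cbox] show ?thesis by (rule subset_antisym)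
qed

lemma is_cube_cell: "0 < s \<Longrightarrow> is_cube s (cell s z)"
proof -
  have "is_interval (cell s z)"
    unfolding is_interval_cart
  proof (intro ballI allI impI)
    fix a b x :: "real ^ 'a"
    assume ab: "a \<in> cell s z" "b \<in> cell s z"
      and x: "\<forall>i. a $ i \<le> x $ i \<and> x $ i \<le> b $ i \<or> b $ i \<le> x $ i \<and> x $ i \<le> a $ i"
    show "x \<in> cell s z"
      unfolding cell_def
    proof (intro CollectI allI)
      fix i
      have "s * z i \<le> a $ i" "a $ i < s * (z i + 1)" "s * z i \<le> b $ i" "b $ i < s * (z i + 1)"
        using ab by (simp_all add: cell_def)
      then show "s * z i \<le> x $ i \<and> x $ i < s * (z i + 1)"
        using x[rule_format, of i] by linarith
    qed
  qed
  moreover assume "0 < s"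
  ultimately show ?thesis using closure_cell unfolding is_cube_def by blast
qed

text \<open>The coordinate hyperplane supports the box, which gives a face. The face has the
  dimension of the hyperplane because it contains a relatively open piece of it.\<close>

lemma facet_of_cbox:
  fixes a :: "real ^ 'n"
  assumes l: "0 < l" and c: "c = a $ i \<or> c = a $ i + l"
  shows "cbox a (a + vec l) \<inter> {x. x $ i = c} facet_of cbox a (a + vec l)"
proof -
  let ?K = "cbox a (a + vec l)" and ?H = "{x :: real ^ 'n. axis i 1 \<bullet> x = c}"
  have H: "{x. x $ i = c} = ?H" by (simp add: inner_axis')
  have face: "?K \<inter> ?H face_of ?K"
    using c
  proof
    assume "c = a $ i"
    then show ?thesis by (intro face_of_Int_supporting_hyperplane_ge) (auto simp: inner_axis' mem_box_cart)
  next
    assume "c = a $ i + l"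
    then show ?thesis by (intro face_of_Int_supporting_hyperplane_le) (auto simp: inner_axis' mem_box_cart)
  qed
  \<comment> \<open>Leaving direction \<open>i\<close> free makes \<open>T\<close> an open set
    containing the centre \<open>p\<close> of the face; cutting a convex set with an open set that
    meets it keeps its dimension.\<close>
  define T where "T = (\<Inter>j\<in>-{i}. {x. a $ j < x $ j} \<inter> {x. x $ j < a $ j + l})"
  have T: "open T" unfolding T_def
    by (intro open_INT ballI open_Int open_halfspace_component_lt_cart open_halfspace_component_gt_cart) auto
  define p where "p = (\<chi> j. if j = i then c else a $ j + l / 2)"
  have p: "p \<in> ?H \<inter> T" using l by (simp add: p_def T_def inner_axis')
  have sub: "?H \<inter> T \<subseteq> ?K \<inter> ?H"
  proof
    fix x assume x: "x \<in> ?H \<inter> T"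
    have "a $ j \<le> x $ j \<and> x $ j \<le> a $ j + l" for j
      using x c l by (cases "j = i") (auto simp: T_def inner_axis' less_imp_le)
    then show "x \<in> ?K \<inter> ?H" using x by (simp add: mem_box_cart)
  qed
  have dimH: "aff_dim ?H = int CARD('n) - 1"
    by (subst aff_dim_hyperplane) (simp_all add: axis_eq_0_iff)
  have "aff_dim (?H \<inter> T) = aff_dim ?H"
    using convex_hyperplane T p by (intro aff_dim_convex_Int_open) auto
  then have "int CARD('n) - 1 \<le> aff_dim (?K \<inter> ?H)"
    using aff_dim_subset[OF sub] dimH by simp
  moreover have "aff_dim (?K \<inter> ?H) \<le> int CARD('n) - 1"
    using aff_dim_subset[of "?K \<inter> ?H" ?H] dimH by simp
  moreover have "aff_dim ?K = int CARD('n)"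
    using l by (subst aff_dim_nonempty_interior) (auto simp: interior_cbox interval_ne_empty_cart)
  ultimately have "aff_dim (?K \<inter> ?H) = aff_dim ?K - 1" by simp
  moreover have "?K \<inter> ?H \<noteq> {}" using p sub by blast
  ultimately show ?thesis using face by (simp add: facet_of_def H)
qed

text \<open>The closures meet where coordinate \<open>i\<close> equals \<open>s * z i + s\<close>,
  the upper side of the first box and the lower side of the second. These pairs are the single steps
  of the chains.\<close>

lemma consecutive_cells:
  assumes s: "0 < s"
  shows "(cell s z, cell s (z(i := z i + 1))) \<in> consecutive_pairs s"
proof -
  let ?a = "\<chi> j. s * z j" and ?b = "\<chi> j. s * (z(i := z i + 1)) j"
  have A: "x \<in> cbox ?a (?a + vec s) \<longleftrightarrow> (s * z i \<le> x $ i \<and> x $ i \<le> s * z i + s) \<and>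
      (\<forall>j. j \<noteq> i \<longrightarrow> s * z j \<le> x $ j \<and> x $ j \<le> s * z j + s)" for x
    by (auto simp: mem_box_cart)
  have B: "x \<in> cbox ?b (?b + vec s) \<longleftrightarrow> (s * z i + s \<le> x $ i \<and> x $ i \<le> s * z i + s + s) \<and>
      (\<forall>j. j \<noteq> i \<longrightarrow> s * z j \<le> x $ j \<and> x $ j \<le> s * z j + s)" for x
  proof -
    have "s * (z(i := z i + 1)) i = s * z i + s" by (simp add: distrib_left)
    moreover have "s * (z(i := z i + 1)) j = s * z j" if "j \<noteq> i" for j using that by simp
    ultimately show ?thesis unfolding mem_box_cart vec_lambda_beta vector_add_component vec_component by metis
  qed
  have bi: "?b $ i = s * z i + s" by (simp add: distrib_left)
  have 1: "cbox ?a (?a + vec s) \<inter> cbox ?b (?b + vec s) = cbox ?a (?a + vec s) \<inter> {x. x $ i = ?a $ i + s}"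
    using s by (intro set_eqI) (auto simp only: Int_iff A B mem_Collect_eq vec_lambda_beta)
  have 2: "cbox ?a (?a + vec s) \<inter> cbox ?b (?b + vec s) = cbox ?b (?b + vec s) \<inter> {x. x $ i = ?b $ i}"
    unfolding bi using s by (intro set_eqI) (auto simp only: Int_iff A B mem_Collect_eq)
  have "closure (cell s z) \<inter> closure (cell s (z(i := z i + 1))) facet_of closure (cell s z)"
    unfolding closure_cell[OF s] 1 by (rule facet_of_cbox[OF s]) simp
  moreover have "closure (cell s z) \<inter> closure (cell s (z(i := z i + 1))) facet_of closure (cell s (z(i := z i + 1)))"
    unfolding closure_cell[OF s] 2 by (rule facet_of_cbox[OF s]) simp
  ultimately show ?thesis
    using is_cube_cell[OF s] by (auto simp: consecutive_pairs_def consecutive_def)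
qed

lemma consecutive_pairs_mono: "\<delta> \<le> \<delta>' \<Longrightarrow> consecutive_pairs \<delta> \<subseteq> consecutive_pairs \<delta>'"
  by (auto simp: consecutive_pairs_def) (meson order_trans)

text \<open>The two cubes have sides \<open>l + 2 * t\<close> and \<open>l - 2 * t\<close>; the
  hypothesis keeps the second nonnegative, so that its power is a volume.\<close>

lemma measure_shell:
  fixes a :: "real ^ 'n"
  assumes t: "0 \<le> t" "2 * t \<le> l"
  shows "measure lebesgue (cbox (a - vec t) (a + vec (l + t)) - box (a + vec t) (a + vec (l - t)))
    = (l + 2 * t) ^ CARD('n) - (l - 2 * t) ^ CARD('n)"
proof -
  have "measure lebesgue (cbox (a - vec t) (a + vec (l + t))) = (l + 2 * t) ^ CARD('n)"
    using t by (subst measure_completion) (auto simp: content_cbox_cart interval_ne_empty_cart algebra_simps)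
  moreover have "measure lebesgue (box (a + vec t) (a + vec (l - t))) = (l - 2 * t) ^ CARD('n)"
    using t content_cbox_cart[of "a + vec t" "a + vec (l - t)"]
    by (simp add: measure_lborel_box_eq measure_lborel_cbox_eq interval_ne_empty_cart algebra_simps)
  moreover have "box (a + vec t) (a + vec (l - t)) \<subseteq> cbox (a - vec t) (a + vec (l + t))"
    using t by (intro subset_interval_imp_cart) simp
  ultimately show ?thesis by (subst measurable_measure_Diff) auto
qed

text \<open>Induction on the l1 distance: each move brings one coordinate one unit closer to
  \<open>w\<close>.\<close>

lemma lattice_chain:
  fixes F :: "('n::finite \<Rightarrow> int) \<Rightarrow> real"
  assumes step: "\<And>z i. \<bar>F z - F (z(i := z i + 1))\<bar> \<le> \<kappa>"
  shows "\<bar>F z - F w\<bar> \<le> \<kappa> * (\<Sum>i\<in>UNIV. \<bar>z i - w i\<bar>)"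
proof (induction "nat (\<Sum>i\<in>UNIV. \<bar>z i - w i\<bar>)" arbitrary: z)
  case 0
  then have "(\<Sum>i\<in>UNIV. \<bar>z i - w i\<bar>) \<le> 0" by simp
  then have "(\<Sum>i\<in>UNIV. \<bar>z i - w i\<bar>) = 0" by (intro antisym sum_nonneg) auto
  moreover from this have "z = w" by (simp add: sum_nonneg_eq_0_iff fun_eq_iff)
  ultimately show ?case by simp
next
  case (Suc n)
  then have "z \<noteq> w" by auto
  then obtain i where i: "z i \<noteq> w i" by auto
  define z' where "z' = z(i := if z i < w i then z i + 1 else z i - 1)"
  have "(\<Sum>j\<in>UNIV - {i}. \<bar>z' j - w j\<bar>) = (\<Sum>j\<in>UNIV - {i}. \<bar>z j - w j\<bar>)"
    by (rule sum.cong) (auto simp: z'_def)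
  moreover have "\<bar>z' i - w i\<bar> = \<bar>z i - w i\<bar> - 1" using i by (auto simp: z'_def)
  ultimately have sum: "(\<Sum>j\<in>UNIV. \<bar>z j - w j\<bar>) = (\<Sum>j\<in>UNIV. \<bar>z' j - w j\<bar>) + 1"
    by (simp add: sum.remove[of UNIV i])
  have "n = nat (\<Sum>j\<in>UNIV. \<bar>z' j - w j\<bar>)" using Suc(2) sum by linarith
  then have IH: "\<bar>F z' - F w\<bar> \<le> \<kappa> * (\<Sum>i\<in>UNIV. \<bar>z' i - w i\<bar>)" by (rule Suc(1))
  \<comment> \<open>A downward move is an upward step read backwards, so \<open>step\<close> is then
    applied at \<open>z'\<close>.\<close>
  have "z = z'(i := z' i + 1)" if "\<not> z i < w i" using that by (simp add: z'_def fun_eq_iff)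
  then have "\<bar>F z - F z'\<bar> \<le> \<kappa>"
    using step[of z i] step[of z' i] by (cases "z i < w i") (auto simp: z'_def abs_minus_commute)
  then have "\<bar>F z - F w\<bar> \<le> \<kappa> * (\<Sum>i\<in>UNIV. \<bar>z' i - w i\<bar>) + \<kappa>" using IH by linarith
  also have "\<dots> = \<kappa> * (\<Sum>i\<in>UNIV. \<bar>z i - w i\<bar>)" unfolding sum by (simp add: algebra_simps)
  finally show ?case .
qed

section \<open>Densities and the epsilon-delta form of smoothness\<close>

text \<open>\<open>A\<close> may be any set: \<open>measure\<close> is 0 on non-measurable sets and
  a quotient by 0 is 0, so the default values respect both bounds.\<close>

lemma set_density_bounds:
  assumes "S \<in> lmeasurable"
  shows "0 \<le> set_density A S" "set_density A S \<le> 1"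
proof -
  have "measure lebesgue (A \<inter> S) \<le> measure lebesgue S"
    using assms measure_mono_fmeasurable[of "A \<inter> S" S lebesgue]
    by (cases "A \<inter> S \<in> sets lebesgue") (auto simp: measure_notin_sets)
  then show "0 \<le> set_density A S" "set_density A S \<le> 1"
    by (simp_all add: set_density_def divide_le_eq_1 zero_less_measure_iff)
qed

text \<open>The bounds on \<open>D\<close> make the differences bounded, and grid cells provide at
  least one pair, so the real supremum is genuine. Monotonicity in \<delta> passes an estimate at
  one scale to all smaller ones.\<close>

lemma SUP_consecutive_tendsto_0_iff:
  fixes D :: "(real ^ 'n) set \<Rightarrow> real"
  assumes D: "\<And>l Q. is_cube l Q \<Longrightarrow> 0 \<le> D Q \<and> D Q \<le> 1"
  shows "((\<lambda>\<delta>. SUP (Q, Q')\<in>consecutive_pairs \<delta>. \<bar>D Q - D Q'\<bar>) \<longlongrightarrow> 0) (at_right 0) \<longleftrightarrow>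
    (\<forall>\<epsilon>>0. \<exists>\<delta>>0. \<forall>(Q, Q')\<in>consecutive_pairs \<delta>. \<bar>D Q - D Q'\<bar> \<le> \<epsilon>)"
    (is "(?S \<longlongrightarrow> 0) _ \<longleftrightarrow> ?R")
proof -
  let ?h = "\<lambda>(Q, Q'). \<bar>D Q - D Q'\<bar>"
  have le1: "?h p \<le> 1" if mem: "p \<in> consecutive_pairs \<delta>" for p \<delta>
  proof -
    obtain Q Q' where p: "p = (Q, Q')" by (cases p)
    then obtain l where "is_cube l Q" "is_cube l Q'"
      using mem by (auto simp: consecutive_pairs_def)
    then show ?thesis using D[of l Q] D[of l Q'] by (simp add: p abs_le_iff)
  qed
  then have bdd: "bdd_above (?h ` consecutive_pairs \<delta>)" for \<delta> by (rule bdd_aboveI2)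
  have ne: "consecutive_pairs \<delta> \<noteq> ({} :: ((real ^ 'n) set \<times> (real ^ 'n) set) set)" if "0 < \<delta>" for \<delta>
    using consecutive_cells[OF that] by blast
  have upper: "?h p \<le> ?S \<delta>" if "p \<in> consecutive_pairs \<delta>" for p \<delta>
    using that bdd by (rule cSUP_upper)
  have nonneg: "0 \<le> ?S \<delta>" if \<delta>: "0 < \<delta>" for \<delta>
  proof -
    obtain p where p: "p \<in> (consecutive_pairs \<delta> :: ((real ^ 'n) set \<times> (real ^ 'n) set) set)" using ne[OF \<delta>] by blast
    have "0 \<le> ?h p" by (simp add: case_prod_unfold)
    then show ?thesis using upper[OF p] by linarith
  qed
  show ?thesis
  proof (intro iffI allI impI)
    fix \<epsilon> :: real assume "(?S \<longlongrightarrow> 0) (at_right 0)" "0 < \<epsilon>"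
    then have "\<forall>\<^sub>F \<delta> in at_right 0. dist (?S \<delta>) 0 < \<epsilon>" by (rule tendstoD)
    then obtain b where b: "0 < b" "\<And>y. 0 < y \<Longrightarrow> y < b \<Longrightarrow> dist (?S y) 0 < \<epsilon>"
      by (auto simp: eventually_at_right_field)
    have "?S (b / 2) \<le> \<epsilon>" using b(2)[of "b / 2"] b(1) by (simp add: dist_real_def abs_less_iff)
    then have "\<forall>(Q, Q')\<in>consecutive_pairs (b / 2). \<bar>D Q - D Q'\<bar> \<le> \<epsilon>"
      using upper[of _ "b / 2"] by fastforce
    then show "\<exists>\<delta>>0. \<forall>(Q, Q')\<in>consecutive_pairs \<delta>. \<bar>D Q - D Q'\<bar> \<le> \<epsilon>"
      using b(1) by (intro exI[of _ "b / 2"]) simp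
  next
    assume R: ?R
    show "(?S \<longlongrightarrow> 0) (at_right 0)"
    proof (rule tendstoI)
      fix e :: real assume "0 < e"
      \<comment> \<open>Convergence asks for a strict inequality, hence half of
        \<open>e\<close>.\<close>
      then obtain \<delta> where \<delta>: "\<delta> > 0" "\<forall>(Q, Q')\<in>consecutive_pairs \<delta>. \<bar>D Q - D Q'\<bar> \<le> e / 2"
        using R[rule_format, of "e / 2"] by auto
      have "dist (?S y) 0 < e" if "0 < y" "y < \<delta>" for y
      proof -
        have "?S y \<le> e / 2"
          using \<delta>(2) consecutive_pairs_mono[of y \<delta>] that by (intro cSUP_least ne) auto
        then show ?thesis using nonneg[OF that(1)] \<open>0 < e\<close> by (simp add: dist_real_def)
      qed
      then show "\<forall>\<^sub>F \<delta> in at_right 0. dist (?S \<delta>) 0 < e"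
        using \<delta>(1) by (auto simp: eventually_at_right_field)
    qed
  qed
qed

section \<open>Densities under bilipschitz maps\<close>

context bilipschitz_homeo
begin

lemma lmeasurable_f: "bounded S \<Longrightarrow> S \<in> sets lebesgue \<Longrightarrow> f ` S \<in> lmeasurable"
  by (intro bounded_set_imp_lmeasurable bounded_f sets_f)

text \<open>An uncovered point of f(Q) shares its cell with a point outside f(Q). Their preimages
  differ by at most \<open>t\<close>, the Lipschitz constant times the bound on the cell diameter.
  One lies in \<open>Q\<close> and the other does not, so the first is close to the boundary of the
  cube.\<close>

lemma image_cube_cover:
  assumes Q: "is_cube l Q" and cl: "closure Q = cbox a (a + vec l)" and s: "0 < s"
  defines "t \<equiv> C * (real CARD('n) * s)"
  shows "f ` Q - (\<Union>z\<in>{z. cell s z \<subseteq> f ` Q}. cell s z)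
    \<subseteq> f ` (cbox (a - vec t) (a + vec (l + t)) - box (a + vec t) (a + vec (l - t)))"
proof
  fix y assume y: "y \<in> f ` Q - (\<Union>z\<in>{z. cell s z \<subseteq> f ` Q}. cell s z)"
  then have gy: "g y \<in> Q" by auto
  have t: "0 \<le> t" using s C by (simp add: t_def)
  let ?z = "\<lambda>i. \<lfloor>y $ i / s\<rfloor>"
  have yz: "y \<in> cell s ?z" by (rule mem_cell_floor[OF s])
  then have "\<not> cell s ?z \<subseteq> f ` Q" using y by blast
  then obtain w where w: "w \<in> cell s ?z" "w \<notin> f ` Q" by blast
  then have gw: "g w \<notin> box a (a + vec l)"
    using cube_superset[OF Q cl] by (metis fg imageI subsetD)
  have "norm (g y - g w) \<le> C * norm (y - w)" by (rule lip_g)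
  also have "\<dots> \<le> t" unfolding t_def using C dist_cell[OF yz w(1)] by (intro mult_left_mono) auto
  finally have d: "\<bar>g y $ i - g w $ i\<bar> \<le> t" for i
    using component_le_norm_cart[of "g y - g w" i] by simp
  have "g y \<in> cbox a (a + vec l)" using cube_subset[OF Q cl] gy by blast
  then have "a $ i \<le> g y $ i \<and> g y $ i \<le> a $ i + l" for i by (simp add: mem_box_cart)
  then have "a $ i - t \<le> g y $ i \<and> g y $ i \<le> a $ i + (l + t)" for i
    using t by (smt (verit))
  then have "g y \<in> cbox (a - vec t) (a + vec (l + t))" by (simp add: mem_box_cart)
  moreover have "g y \<notin> box (a + vec t) (a + vec (l - t))"
  proof
    assume "g y \<in> box (a + vec t) (a + vec (l - t))"
    then have b: "a $ i + t < g y $ i" "g y $ i < a $ i + (l - t)" for i by (auto simp: mem_box_cart)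
    have "a $ i < g w $ i \<and> g w $ i < a $ i + l" for i
      using b[of i] d[of i] by linarith
    then show False using gw by (simp add: mem_box_cart)
  qed
  ultimately show "y \<in> f ` (cbox (a - vec t) (a + vec (l + t)) - box (a + vec t) (a + vec (l - t)))"
    by (intro image_eqI[of _ _ "g y"]) simp_all
qed

text \<open>The image splits into the cells it contains, where \<open>B\<close> has density close to
  \<open>d\<close>, and a remainder. The remainder is charged with its full measure, which is small
  because it lies in the image of the shell.\<close>

lemma image_cube_density_estimate:
  assumes B: "B \<in> sets lebesgue" and Q: "is_cube l Q"
    and \<eta>: "0 < \<eta>" and d: "0 \<le> d" "d \<le> 1"
    and \<kappa>: "0 \<le> \<kappa>" "\<And>z. cell (\<eta> * l) z \<subseteq> f ` Q \<Longrightarrow> \<bar>set_density B (cell (\<eta> * l) z) - d\<bar> \<le> \<kappa>"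
  defines "\<tau> \<equiv> C * (real CARD('n) * \<eta>)"
  assumes \<tau>: "2 * \<tau> \<le> 1"
  shows "\<bar>set_density B (f ` Q) - d\<bar> \<le> \<kappa> + M\<^sup>2 * ((1 + 2 * \<tau>) ^ CARD('n) - (1 - 2 * \<tau>) ^ CARD('n))"
proof -
  let ?\<mu> = "measure lebesgue" and ?n = "CARD('n)"
  obtain a where l: "0 < l" and cl: "closure Q = cbox a (a + vec l)" using Q by (auto simp: is_cube_def)
  define s where "s = \<eta> * l"
  have s: "0 < s" using \<eta> l by (simp add: s_def)
  define Z where "Z = {z. cell s z \<subseteq> f ` Q}"
  define U where "U = (\<Union>z\<in>Z. cell s z)"
  have bQ: "bounded Q" and mQ: "Q \<in> sets lebesgue" and \<mu>Q: "?\<mu> Q = l ^ ?n"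
    using bounded_cube[OF Q cl] lmeasurable_cube[OF Q cl] measure_cube[OF Q cl] by auto
  have fQ: "f ` Q \<in> lmeasurable" using bQ mQ by (rule lmeasurable_f)
  have finZ: "finite Z" unfolding Z_def using s bounded_f[OF bQ] by (rule finite_cells)
  have cellm: "cell s z \<in> lmeasurable" "?\<mu> (cell s z) = s ^ ?n" for z :: "'n \<Rightarrow> int"
    using lmeasurable_cube[OF is_cube_cell[OF s] closure_cell[OF s]]
      measure_cube[OF is_cube_cell[OF s] closure_cell[OF s]] by auto
  have Bcell: "B \<inter> cell s z \<in> lmeasurable" for z
    using fmeasurable_Int_fmeasurable[OF cellm(1) B] by (simp add: Int_commute)
  have U: "U \<in> lmeasurable" unfolding U_def using finZ cellm(1) by (intro fmeasurable.finite_UN) auto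
  have Usub: "U \<subseteq> f ` Q" by (auto simp: U_def Z_def)
  have disj: "pairwise (\<lambda>z w. disjnt (cell s z) (cell s w)) Z"
    using disjoint_cells[OF s] unfolding pairwise_def disjnt_def by blast
  have disjB: "pairwise (\<lambda>z w. disjnt (B \<inter> cell s z) (B \<inter> cell s w)) Z"
    using disjoint_cells[OF s] unfolding pairwise_def disjnt_def by blast
  have \<mu>U: "?\<mu> U = (\<Sum>z\<in>Z. s ^ ?n)"
    unfolding U_def using finZ cellm disj by (subst measure_UNION') auto
  have "?\<mu> (B \<inter> U) = ?\<mu> (\<Union>z\<in>Z. B \<inter> cell s z)" by (simp only: U_def Int_UN_distrib)
  also have "\<dots> = (\<Sum>z\<in>Z. ?\<mu> (B \<inter> cell s z))"
    by (rule measure_UNION'[OF finZ Bcell disjB])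
  finally have "?\<mu> (B \<inter> U) - d * ?\<mu> U = (\<Sum>z\<in>Z. ?\<mu> (B \<inter> cell s z) - d * s ^ ?n)"
    by (simp add: \<mu>U sum_subtractf)
  also have "\<bar>\<dots>\<bar> \<le> (\<Sum>z\<in>Z. \<kappa> * s ^ ?n)"
  proof (rule order_trans[OF sum_abs], rule sum_mono)
    fix z assume "z \<in> Z"
    then have "\<bar>?\<mu> (B \<inter> cell s z) / s ^ ?n - d\<bar> \<le> \<kappa>"
      using \<kappa>(2)[of z] by (simp add: Z_def s_def[symmetric] set_density_def cellm(2))
    then have "\<bar>?\<mu> (B \<inter> cell s z) / s ^ ?n - d\<bar> * s ^ ?n \<le> \<kappa> * s ^ ?n"
      using s by (intro mult_right_mono) auto
    moreover have "\<bar>?\<mu> (B \<inter> cell s z) / s ^ ?n - d\<bar> * s ^ ?n = \<bar>(?\<mu> (B \<inter> cell s z) / s ^ ?n - d) * s ^ ?n\<bar>"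
      using s by (simp add: abs_mult)
    ultimately show "\<bar>?\<mu> (B \<inter> cell s z) - d * s ^ ?n\<bar> \<le> \<kappa> * s ^ ?n"
      using s by (simp add: left_diff_distrib)
  qed
  also have "\<dots> = \<kappa> * ?\<mu> U" by (simp add: \<mu>U sum_distrib_left)
  finally have main: "\<bar>?\<mu> (B \<inter> U) - d * ?\<mu> U\<bar> \<le> \<kappa> * ?\<mu> U" .
  define R where "R = f ` Q - U"
  have R: "R \<in> lmeasurable" unfolding R_def using fQ U by (intro fmeasurable_Diff) auto
  have split: "?\<mu> (f ` Q) = ?\<mu> U + ?\<mu> R"
    using measurable_measure_Diff[OF fQ, of U] U Usub by (simp add: R_def)
  have "B \<inter> f ` Q \<in> lmeasurable"
    using fmeasurable_Int_fmeasurable[OF fQ B] by (simp add: Int_commute)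
  moreover have "B \<inter> R = B \<inter> f ` Q - B \<inter> U" by (auto simp: R_def)
  ultimately have splitB: "?\<mu> (B \<inter> f ` Q) = ?\<mu> (B \<inter> U) + ?\<mu> (B \<inter> R)"
    using measurable_measure_Diff[of "B \<inter> f ` Q" lebesgue "B \<inter> U"] B U Usub
    by (simp add: fmeasurableD le_infI2)
  \<comment> \<open>The measure of \<open>B \<inter> R\<close> and \<open>d\<close> times that of
    \<open>R\<close> both lie between 0 and the measure of \<open>R\<close>, which therefore bounds
    their difference.\<close>
  have "0 \<le> ?\<mu> (B \<inter> R)" "?\<mu> (B \<inter> R) \<le> ?\<mu> R" "0 \<le> d * ?\<mu> R" "d * ?\<mu> R \<le> ?\<mu> R"
    using measure_mono_fmeasurable[OF _ _ R, of "B \<inter> R"] B R d by (auto simp: mult_left_le_one_le)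
  then have "\<bar>?\<mu> (B \<inter> R) - d * ?\<mu> R\<bar> \<le> ?\<mu> R" by linarith
  moreover have "\<kappa> * ?\<mu> U \<le> \<kappa> * ?\<mu> (f ` Q)"
    using \<kappa>(1) split by (intro mult_left_mono) auto
  moreover have "?\<mu> (B \<inter> f ` Q) - d * ?\<mu> (f ` Q) = (?\<mu> (B \<inter> U) - d * ?\<mu> U) + (?\<mu> (B \<inter> R) - d * ?\<mu> R)"
    by (simp add: split splitB algebra_simps)
  ultimately have est: "\<bar>?\<mu> (B \<inter> f ` Q) - d * ?\<mu> (f ` Q)\<bar> \<le> \<kappa> * ?\<mu> (f ` Q) + ?\<mu> R"
    using main by linarith
  \<comment> \<open>This is the shell width of \<open>image_cube_cover\<close>. As it equals
    \<open>\<tau> * l\<close>, the volume of the shell relative to the cube depends on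
    \<open>\<tau>\<close> only.\<close>
  define t where "t = C * (real ?n * s)"
  have t: "t = \<tau> * l" by (simp add: t_def \<tau>_def s_def)
  have t0: "0 \<le> t" using s C by (simp add: t_def)
  have t1: "2 * t \<le> l" using \<tau> l by (simp add: t mult_left_le_one_le flip: mult.assoc)
  let ?K = "cbox (a - vec t) (a + vec (l + t)) - box (a + vec t) (a + vec (l - t))"
  have K: "bounded ?K" "?K \<in> sets lebesgue" using bounded_cbox bounded_diff by auto
  have "?\<mu> R \<le> ?\<mu> (f ` ?K)"
    using image_cube_cover[OF Q cl s] lmeasurable_f[OF K] R
    by (intro measure_mono_fmeasurable) (auto simp: R_def U_def Z_def t_def)
  also have "\<dots> \<le> M * ?\<mu> ?K" by (rule measure_f[OF K])
  also have "?\<mu> ?K = (l + 2 * t) ^ ?n - (l - 2 * t) ^ ?n" using t0 t1 by (rule measure_shell)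
  also have "\<dots> = l ^ ?n * ((1 + 2 * \<tau>) ^ ?n - (1 - 2 * \<tau>) ^ ?n)"
    by (simp add: t right_diff_distrib flip: power_mult_distrib) (simp add: algebra_simps)
  \<comment> \<open>One factor \<open>M\<close> comes from mapping the shell by \<open>f\<close>;
    the second compares the measure of \<open>Q\<close> with that of its image.\<close>
  also have "M * \<dots> \<le> M * (M * ?\<mu> (f ` Q) * ((1 + 2 * \<tau>) ^ ?n - (1 - 2 * \<tau>) ^ ?n))"
  proof -
    have "0 \<le> \<tau>" using \<eta> C by (simp add: \<tau>_def)
    then have "0 \<le> (1 + 2 * \<tau>) ^ ?n - (1 - 2 * \<tau>) ^ ?n"
      using \<tau> by (simp add: power_mono)
    moreover have "l ^ ?n \<le> M * ?\<mu> (f ` Q)" using measure_f_ge[OF bQ mQ] by (simp add: \<mu>Q)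
    ultimately show ?thesis using M by (intro mult_left_mono mult_right_mono) auto
  qed
  finally have R_le: "?\<mu> R \<le> M\<^sup>2 * ((1 + 2 * \<tau>) ^ ?n - (1 - 2 * \<tau>) ^ ?n) * ?\<mu> (f ` Q)"
    by (simp add: power2_eq_square mult_ac)
  have "0 < M * ?\<mu> (f ` Q)" using measure_f_ge[OF bQ mQ] zero_less_power[OF l, of ?n] unfolding \<mu>Q by linarith
  then have pos: "0 < ?\<mu> (f ` Q)" using M by (simp add: zero_less_mult_iff)
  have "\<bar>?\<mu> (B \<inter> f ` Q) - d * ?\<mu> (f ` Q)\<bar>
      \<le> (\<kappa> + M\<^sup>2 * ((1 + 2 * \<tau>) ^ ?n - (1 - 2 * \<tau>) ^ ?n)) * ?\<mu> (f ` Q)"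
    using est R_le by (simp add: distrib_right)
  moreover have "set_density B (f ` Q) - d = (?\<mu> (B \<inter> f ` Q) - d * ?\<mu> (f ` Q)) / ?\<mu> (f ` Q)"
    using pos by (simp add: set_density_def diff_divide_distrib)
  ultimately show ?thesis using pos by (simp add: abs_divide pos_divide_le_eq)
qed

lemma image_density_consecutive:
  assumes B: "B \<in> sets lebesgue"
    and smooth: "\<And>\<epsilon>. 0 < \<epsilon> \<Longrightarrow> \<exists>\<delta>>0. \<forall>(Q, Q')\<in>consecutive_pairs \<delta>. \<bar>set_density B Q - set_density B Q'\<bar> \<le> \<epsilon>"
    and \<epsilon>: "0 < \<epsilon>"
  shows "\<exists>\<delta>>0. \<forall>(Q, Q')\<in>consecutive_pairs \<delta>. \<bar>set_density B (f ` Q) - set_density B (f ` Q')\<bar> \<le> \<epsilon>"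
proof -
  let ?n = "CARD('n)"
  have n: "real ?n \<ge> 1" by (simp add: Suc_leI)
  \<comment> \<open>The shell term is continuous in \<open>\<tau>\<close> and vanishes at 0, so some
    positive \<open>\<tau>\<close> below 1/2 makes it less than
    \<open>\<epsilon> / 4\<close>.\<close>
  have "isCont (\<lambda>\<tau>::real. M\<^sup>2 * ((1 + 2 * \<tau>) ^ ?n - (1 - 2 * \<tau>) ^ ?n)) 0" by (intro continuous_intros)
  then have "(\<lambda>\<tau>::real. M\<^sup>2 * ((1 + 2 * \<tau>) ^ ?n - (1 - 2 * \<tau>) ^ ?n)) \<midarrow>0\<rightarrow> 0"
    by (simp add: isCont_def)
  then have "\<forall>\<^sub>F \<tau> in at_right 0. M\<^sup>2 * ((1 + 2 * \<tau>) ^ ?n - (1 - 2 * \<tau>) ^ ?n) < \<epsilon> / 4"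
    using \<epsilon> by (intro order_tendstoD(2)[of _ 0]) (auto simp: filterlim_at_split)
  moreover have "\<forall>\<^sub>F \<tau> in at_right (0::real). \<tau> < 1 / 2" by (rule eventually_at_right_real[of 0 "1/2", THEN eventually_mono]) auto
  moreover have "\<forall>\<^sub>F \<tau> in at_right (0::real). 0 < \<tau>" by (rule eventually_at_right_less)
  ultimately have "\<forall>\<^sub>F \<tau> in at_right (0::real). 0 < \<tau> \<and> \<tau> < 1 / 2 \<and>
      M\<^sup>2 * ((1 + 2 * \<tau>) ^ ?n - (1 - 2 * \<tau>) ^ ?n) < \<epsilon> / 4" by eventually_elim simp
  then obtain \<tau> :: real where \<tau>: "0 < \<tau>" "\<tau> < 1 / 2" "M\<^sup>2 * ((1 + 2 * \<tau>) ^ ?n - (1 - 2 * \<tau>) ^ ?n) < \<epsilon> / 4"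
    using eventually_happens'[OF trivial_limit_at_right_real] by blast
  \<comment> \<open>Chosen so that the parameter of \<open>image_cube_density_estimate\<close> is
    exactly \<open>\<tau>\<close>.\<close>
  define \<eta> where "\<eta> = \<tau> / (C * real ?n)"
  have \<eta>: "0 < \<eta>" "C * (real ?n * \<eta>) = \<tau>" using \<tau>(1) C n by (auto simp: \<eta>_def)
  \<comment> \<open>\<open>L\<close> bounds the length of a chain: each of the \<open>?n\<close>
    coordinates contributes at most \<open>C * ?n / \<eta> + 1\<close>. Steps of size
    \<open>\<epsilon> / (4 * L)\<close> then cost at most \<open>\<epsilon> / 4\<close> in
    total.\<close>
  define L where "L = real ?n * (C * real ?n / \<eta> + 1)"
  have L: "0 < L" using n C \<eta>(1) unfolding L_def by (intro mult_pos_pos add_nonneg_pos) auto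
  obtain \<delta>0 where \<delta>0: "0 < \<delta>0"
    "\<forall>(Q, Q')\<in>consecutive_pairs \<delta>0. \<bar>set_density B Q - set_density B Q'\<bar> \<le> \<epsilon> / (4 * L)"
    using smooth[of "\<epsilon> / (4 * L)"] \<epsilon> L by auto
  \<comment> \<open>For cubes of side \<open>l\<close> at most \<open>\<delta>0 / \<eta>\<close>,
    the cells have side \<open>\<eta> * l\<close>, at most \<open>\<delta>0\<close>.\<close>
  have "\<bar>set_density B (f ` Q) - set_density B (f ` Q')\<bar> \<le> \<epsilon>"
    if pair: "(Q, Q') \<in> consecutive_pairs (\<delta>0 / \<eta>)" for Q Q'
  proof -
    obtain l where l: "l \<le> \<delta>0 / \<eta>" "is_cube l Q" "is_cube l Q'"
      and ne: "closure Q \<inter> closure Q' \<noteq> {}"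
      using pair by (auto simp: consecutive_pairs_def consecutive_def facet_of_def)
    then obtain p where p: "p \<in> closure Q" "p \<in> closure Q'" by blast
    have l0: "0 < l" using l(2) by (simp add: is_cube_def)
    define s where "s = \<eta> * l"
    have s: "0 < s" "s \<le> \<delta>0" using \<eta>(1) l0 l(1) by (auto simp: s_def field_simps)
    \<comment> \<open>The reference cell contains the image of a common point of both closures, so
      the same \<open>d\<close> serves both cubes.\<close>
    define w where "w = (\<lambda>i. \<lfloor>f p $ i / s\<rfloor>)"
    have w: "f p \<in> cell s w" unfolding w_def by (rule mem_cell_floor[OF s(1)])
    define d where "d = set_density B (cell s w)"
    have d: "0 \<le> d" "d \<le> 1"
      using set_density_bounds[OF lmeasurable_cube[OF is_cube_cell closure_cell], OF s(1) s(1)]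
      by (auto simp: d_def)
    have step: "\<bar>set_density B (cell s z) - set_density B (cell s (z(i := z i + 1)))\<bar> \<le> \<epsilon> / (4 * L)" for z i
      using \<delta>0(2) consecutive_cells[OF s(1), of z i] consecutive_pairs_mono[OF s(2)] by blast
    \<comment> \<open>Chain and shell contribute \<open>\<epsilon> / 4\<close> each; the two cubes
      together then give \<open>\<epsilon>\<close>.\<close>
    have near: "\<bar>set_density B (f ` K) - d\<bar> \<le> \<epsilon> / 2" if K: "is_cube l K" "p \<in> closure K" for K
    proof -
      obtain a where cl: "closure K = cbox a (a + vec l)" using K(1) by (auto simp: is_cube_def)
      have "\<bar>set_density B (cell s z) - d\<bar> \<le> \<epsilon> / 4" if z: "cell s z \<subseteq> f ` K" for z
      proof -
        have corner: "(\<chi> i. s * z i) \<in> cell s z" by (rule corner_in_cell[OF s(1)])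
        then obtain q where q: "q \<in> K" "(\<chi> i. s * z i) = f q" using z by blast
        have "q \<in> cbox a (a + vec l)" "p \<in> cbox a (a + vec l)"
          using q(1) K(2) closure_subset[of K] unfolding cl by blast+
        then have "a $ i \<le> q $ i \<and> q $ i \<le> a $ i + l \<and> a $ i \<le> p $ i \<and> p $ i \<le> a $ i + l" for i
          by (simp add: mem_box_cart)
        then have "\<bar>(q - p) $ i\<bar> \<le> l" for i
          unfolding vector_minus_component by (smt (verit))
        then have "norm (q - p) \<le> real ?n * l" by (rule norm_le_card_mult)
        then have "C * norm (q - p) \<le> C * (real ?n * l)" using C by (intro mult_left_mono) auto
        then have "norm (f q - f p) \<le> C * (real ?n * l)" using lip_f[of q p] by linarith
        then have "norm (f q - f p) / s \<le> C * (real ?n * l) / s" using s by (intro divide_right_mono) auto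
        also have "\<dots> = C * real ?n / \<eta>" using l0 by (simp add: s_def)
        finally have "\<bar>z i - w i\<bar> \<le> C * real ?n / \<eta> + 1" for i
          using cell_index_distance[OF s(1) corner w, of i] unfolding q(2) by linarith
        then have "real_of_int (\<Sum>i\<in>UNIV. \<bar>z i - w i\<bar>) \<le> (\<Sum>i\<in>(UNIV::'n set). C * real ?n / \<eta> + 1)"
          unfolding of_int_sum by (rule sum_mono)
        then have "real_of_int (\<Sum>i\<in>UNIV. \<bar>z i - w i\<bar>) \<le> L" by (simp add: L_def)
        then have "\<epsilon> / (4 * L) * real_of_int (\<Sum>i\<in>UNIV. \<bar>z i - w i\<bar>) \<le> \<epsilon> / (4 * L) * L"
          using \<epsilon> L by (intro mult_left_mono) auto
        then show ?thesis
          using lattice_chain[of "\<lambda>z. set_density B (cell s z)", OF step, of z w] L by (simp add: d_def)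
      qed
      then have "\<bar>set_density B (f ` K) - d\<bar> \<le> \<epsilon> / 4 + M\<^sup>2 * ((1 + 2 * \<tau>) ^ ?n - (1 - 2 * \<tau>) ^ ?n)"
        using image_cube_density_estimate[OF B K(1) \<eta>(1) d, of "\<epsilon> / 4"] \<epsilon> \<tau>(2) unfolding s_def \<eta>(2) by auto
      then show ?thesis using \<tau>(3) by linarith
    qed
    show ?thesis using near[OF l(2) p(1)] near[OF l(3) p(2)] by linarith
  qed
  then show ?thesis using \<delta>0(1) \<eta>(1) by (intro exI[of _ "\<delta>0 / \<eta>"]) auto
qed

end

section \<open>Densities compared through the Jacobian\<close>

text \<open>On a set \<open>S\<close> of small diameter the Jacobian is nearly constant, so \<phi>
  multiplies the measure of every measurable part of \<open>S\<close> by nearly the same factor.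
  This factor cancels in the quotient of the measures for \<open>S\<close> and for its part in the
  preimage of \<open>A\<close>.\<close>

lemma density_image_vimage:
  fixes \<phi> :: "real ^ 'n \<Rightarrow> real ^ 'n"
  assumes h: "bilipschitz_homeo \<phi> \<psi> C M" and C1: "C1_map \<phi>"
    and uc: "uniformly_continuous_on UNIV (jacobian_det \<phi>)"
    and A: "A \<in> sets lebesgue" and \<epsilon>: "0 < \<epsilon>"
  shows "\<exists>\<delta>>0. \<forall>S. bounded S \<longrightarrow> S \<in> sets lebesgue \<longrightarrow> 0 < measure lebesgue S \<longrightarrow>
    (\<forall>x\<in>S. \<forall>y\<in>S. dist x y < \<delta>) \<longrightarrow> \<bar>set_density A (\<phi> ` S) - set_density (\<phi> -` A) S\<bar> \<le> \<epsilon>"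
proof -
  interpret bilipschitz_homeo \<phi> \<psi> C M by (rule h)
  interpret inv: bilipschitz_homeo \<psi> \<phi> C M by (rule inverse)
  let ?\<mu> = "measure lebesgue" and ?B = "\<phi> -` A"
  have B: "?B \<in> sets lebesgue" unfolding vimage_f by (rule inv.sets_f[OF A])
  \<comment> \<open>The cross-multiplied error below is \<open>2 * e * ?b * ?q\<close>, where
    \<open>?b\<close> is at most \<open>M * ?D\<close>; this choice leaves exactly
    \<open>\<epsilon> * (?D * ?q)\<close>.\<close>
  define e where "e = \<epsilon> / (2 * M)"
  have e: "0 < e" using \<epsilon> M by (simp add: e_def)
  obtain \<delta> where \<delta>: "0 < \<delta>" "\<And>x y. dist x y < \<delta> \<Longrightarrow> \<bar>jacobian_det \<phi> x - jacobian_det \<phi> y\<bar> < e"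
    using uc e unfolding uniformly_continuous_on_def by (metis UNIV_I dist_real_def)
  have deriv: "(\<phi> has_derivative (\<lambda>v. jacobian \<phi> (at x) *v v)) (at x)" for x
    using C1 jacobian_works[of \<phi> "at x"] by (simp add: C1_map_def)
  have inj: "inj \<phi>" by (metis gf injI)
  have "\<bar>set_density A (\<phi> ` S) - set_density ?B S\<bar> \<le> \<epsilon>"
    if S: "bounded S" "S \<in> sets lebesgue" and pos: "0 < ?\<mu> S" and diam: "\<forall>x\<in>S. \<forall>y\<in>S. dist x y < \<delta>" for S
  proof -
    have "S \<noteq> {}" using pos by auto
    then obtain x0 where x0: "x0 \<in> S" by blast
    define j where "j = \<bar>jacobian_det \<phi> x0\<bar>"
    have j: "j - e \<le> \<bar>det (matrix ((*v) (jacobian \<phi> (at x))))\<bar>"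
      "\<bar>det (matrix ((*v) (jacobian \<phi> (at x))))\<bar> \<le> j + e" if "x \<in> S" for x
      using \<delta>(2)[of x x0] diam x0 that by (auto simp: j_def jacobian_det_def)
    have bound: "\<bar>?\<mu> (\<phi> ` T) - j * ?\<mu> T\<bar> \<le> e * ?\<mu> T" if T: "T \<subseteq> S" "T \<in> sets lebesgue" for T
    proof -
      have "T \<in> lmeasurable" using T(2) bounded_subset[OF S(1) T(1)] by (simp add: bounded_set_imp_lmeasurable)
      then have "(j - e) * ?\<mu> T \<le> ?\<mu> (\<phi> ` T)" "?\<mu> (\<phi> ` T) \<le> (j + e) * ?\<mu> T"
        using measure_differentiable_image_bounds(2,3)[OF _ has_derivative_at_withinI[OF deriv]
            inj_on_subset[OF inj subset_UNIV], of T "j - e" "j + e"] j T(1) by (meson subsetD)+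
      then show ?thesis by (simp add: abs_le_iff algebra_simps)
    qed
    let ?b = "?\<mu> (?B \<inter> S)" and ?q = "?\<mu> S" and ?N = "?\<mu> (\<phi> ` (?B \<inter> S))" and ?D = "?\<mu> (\<phi> ` S)"
    have N: "\<bar>?N - j * ?b\<bar> \<le> e * ?b" using B S(2) by (intro bound) auto
    have D: "\<bar>?D - j * ?q\<bar> \<le> e * ?q" using S(2) by (intro bound) auto
    have im: "A \<inter> \<phi> ` S = \<phi> ` (?B \<inter> S)" by auto
    have q: "?q \<le> M * ?D" using S by (rule measure_f_ge)
    then have "0 < M * ?D" using pos by linarith
    then have Dpos: "0 < ?D" using M by (simp add: zero_less_mult_iff)
    have bq: "?b \<le> ?q"
      using B S by (intro measure_mono_fmeasurable) (auto intro: bounded_set_imp_lmeasurable)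
    \<comment> \<open>Subtracting \<open>j * ?b * ?q\<close> from both products exposes the two
      errors \<open>N\<close> and \<open>D\<close>.\<close>
    have "\<bar>?N * ?q - ?b * ?D\<bar> = \<bar>(?N - j * ?b) * ?q - ?b * (?D - j * ?q)\<bar>" by (simp add: algebra_simps)
    also have "\<dots> \<le> \<bar>?N - j * ?b\<bar> * ?q + ?b * \<bar>?D - j * ?q\<bar>"
      using abs_triangle_ineq4[of "(?N - j * ?b) * ?q" "?b * (?D - j * ?q)"] by (simp add: abs_mult)
    also have "\<dots> \<le> (e * ?b) * ?q + ?b * (e * ?q)"
      using N D by (intro add_mono mult_left_mono mult_right_mono) auto
    also have "\<dots> = 2 * e * ?b * ?q" by simp
    also have "\<dots> \<le> 2 * e * (M * ?D) * ?q"
      using e bq q by (intro mult_right_mono mult_left_mono) auto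
    also have "\<dots> = \<epsilon> * (?D * ?q)" using M by (simp add: e_def)
    finally have le: "\<bar>?N * ?q - ?b * ?D\<bar> \<le> \<epsilon> * (?D * ?q)" .
    have "set_density A (\<phi> ` S) - set_density ?B S = (?N * ?q - ?b * ?D) / (?D * ?q)"
      using Dpos pos by (simp add: set_density_def im diff_frac_eq)
    then have "\<bar>set_density A (\<phi> ` S) - set_density ?B S\<bar> = \<bar>?N * ?q - ?b * ?D\<bar> / (?D * ?q)"
      using Dpos pos by (simp add: abs_divide abs_mult)
    also have "\<dots> \<le> \<epsilon>" using le Dpos pos by (simp add: pos_divide_le_eq)
    finally show ?thesis .
  qed
  then show ?thesis using \<delta>(1) by blast
qed

section \<open>The three smoothness conditions compared\<close>

lemma dist_cube_le:
  fixes Q :: "(real ^ 'n) set"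
  assumes Q: "is_cube l Q" and "x \<in> Q" "y \<in> Q"
  shows "dist x y \<le> real CARD('n) * l"
proof -
  obtain a where "closure Q = cbox a (a + vec l)" using Q by (auto simp: is_cube_def)
  then have "x \<in> cbox a (a + vec l)" "y \<in> cbox a (a + vec l)" using assms closure_subset by blast+
  then have xy: "a $ i \<le> x $ i" "x $ i \<le> a $ i + l" "a $ i \<le> y $ i" "y $ i \<le> a $ i + l" for i
    by (auto simp: mem_box_cart)
  have "\<bar>(x - y) $ i\<bar> \<le> l" for i using xy[of i] by (simp add: abs_le_iff)
  then show ?thesis unfolding dist_norm by (rule norm_le_card_mult)
qed

theorem theorem2:
  fixes \<phi> :: "real ^ 'n \<Rightarrow> real ^ 'n" and A :: "(real ^ 'n) set"
  assumes "bilipschitz \<phi>"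
    and "C1_map \<phi>"
    and "uniformly_continuous_on UNIV (jacobian_det \<phi>)"
    and "A \<in> sets lebesgue"
  shows "(smooth_set A \<longleftrightarrow> smooth_set (\<phi> -` A)) \<and>
    (smooth_set A \<longleftrightarrow>
      ((\<lambda>\<delta>. SUP (Q, Q')\<in>consecutive_pairs \<delta>.
              \<bar>set_density A (\<phi> ` Q) - set_density A (\<phi> ` Q')\<bar>) \<longlongrightarrow> 0) (at_right 0))"
proof -
  obtain \<psi> C M where h: "bilipschitz_homeo \<phi> \<psi> C M"
    by (rule bilipschitz_C1_homeo[OF assms(1,2)])
  interpret bilipschitz_homeo \<phi> \<psi> C M by (rule h)
  interpret inv: bilipschitz_homeo \<psi> \<phi> C M by (rule inverse)
  let ?B = "\<phi> -` A"
  have B: "?B \<in> sets lebesgue" unfolding vimage_f by (rule inv.sets_f[OF assms(4)])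
  \<comment> \<open>Densities in cubes and in their images are both treated as functions of the
    cube, so one criterion covers all three conditions.\<close>
  define osc where "osc D \<longleftrightarrow> (\<forall>\<epsilon>>0. \<exists>\<delta>>0. \<forall>(Q, Q')\<in>consecutive_pairs \<delta>. \<bar>D Q - D Q'\<bar> \<le> \<epsilon>)"
    for D :: "(real ^ 'n) set \<Rightarrow> real"
  have cube: "Q \<in> lmeasurable" "Q \<in> sets lebesgue" "bounded Q" "0 < measure lebesgue Q"
    if Q: "is_cube l Q" for l and Q :: "(real ^ 'n) set"
  proof -
    obtain a where l: "0 < l" and cl: "closure Q = cbox a (a + vec l)" using Q by (auto simp: is_cube_def)
    show "Q \<in> lmeasurable" "Q \<in> sets lebesgue" "bounded Q" "0 < measure lebesgue Q"
      using lmeasurable_cube[OF Q cl] bounded_cube[OF Q cl] measure_cube[OF Q cl] l by auto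
  qed
  have bounds: "0 \<le> set_density E Q \<and> set_density E Q \<le> 1"
    "0 \<le> set_density E (\<phi> ` Q) \<and> set_density E (\<phi> ` Q) \<le> 1"
    if Q: "is_cube l Q" for l and E Q :: "(real ^ 'n) set"
    using set_density_bounds[OF cube(1)[OF Q], of E]
      set_density_bounds[OF lmeasurable_f[OF cube(3,2)[OF Q]], of E] by auto
  have smooth: "smooth_set E \<longleftrightarrow> osc (set_density E)" if "E \<in> sets lebesgue" for E
    unfolding smooth_set_def osc_def
    using that SUP_consecutive_tendsto_0_iff[of "set_density E", OF bounds(1)] by simp
  have smooth_image: "((\<lambda>\<delta>. SUP (Q, Q')\<in>consecutive_pairs \<delta>.
      \<bar>set_density A (\<phi> ` Q) - set_density A (\<phi> ` Q')\<bar>) \<longlongrightarrow> 0) (at_right 0)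
    \<longleftrightarrow> osc (\<lambda>Q. set_density A (\<phi> ` Q))"
    unfolding osc_def using bounds(2) by (rule SUP_consecutive_tendsto_0_iff)
  \<comment> \<open>A three-term estimate: \<open>D'\<close> is replaced by \<open>D\<close> at both
    cubes, and \<open>D\<close> oscillates little between them.\<close>
  have transfer: "osc D \<Longrightarrow> osc D'"
    if close: "\<And>\<epsilon>. 0 < \<epsilon> \<Longrightarrow> \<exists>\<delta>>0. \<forall>l Q. is_cube l Q \<longrightarrow> l \<le> \<delta> \<longrightarrow> \<bar>D Q - D' Q\<bar> \<le> \<epsilon>" for D D'
    unfolding osc_def
  proof (intro allI impI)
    fix \<epsilon> :: real
    assume *: "\<forall>\<epsilon>>0. \<exists>\<delta>>0. \<forall>(Q, Q')\<in>consecutive_pairs \<delta>. \<bar>D Q - D Q'\<bar> \<le> \<epsilon>" and \<epsilon>: "0 < \<epsilon>"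
    obtain \<delta>1 where \<delta>1: "0 < \<delta>1" "\<forall>(Q, Q')\<in>consecutive_pairs \<delta>1. \<bar>D Q - D Q'\<bar> \<le> \<epsilon> / 3"
      using *[rule_format, of "\<epsilon> / 3"] \<epsilon> by auto
    obtain \<delta>2 where \<delta>2: "0 < \<delta>2" "\<And>l Q. is_cube l Q \<Longrightarrow> l \<le> \<delta>2 \<Longrightarrow> \<bar>D Q - D' Q\<bar> \<le> \<epsilon> / 3"
      using close[of "\<epsilon> / 3"] \<epsilon> by auto
    have "\<bar>D' Q - D' Q'\<bar> \<le> \<epsilon>" if pair: "(Q, Q') \<in> consecutive_pairs (min \<delta>1 \<delta>2)" for Q Q'
    proof -
      obtain l where "l \<le> min \<delta>1 \<delta>2" "is_cube l Q" "is_cube l Q'"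
        using pair by (auto simp: consecutive_pairs_def)
      then have "\<bar>D Q - D' Q\<bar> \<le> \<epsilon> / 3" "\<bar>D Q' - D' Q'\<bar> \<le> \<epsilon> / 3" using \<delta>2(2) by auto
      moreover have "\<bar>D Q - D Q'\<bar> \<le> \<epsilon> / 3"
        using \<delta>1(2) consecutive_pairs_mono[of "min \<delta>1 \<delta>2" \<delta>1] pair by auto
      ultimately show ?thesis by linarith
    qed
    then show "\<exists>\<delta>>0. \<forall>(Q, Q')\<in>consecutive_pairs \<delta>. \<bar>D' Q - D' Q'\<bar> \<le> \<epsilon>"
      using \<delta>1(1) \<delta>2(1) by (intro exI[of _ "min \<delta>1 \<delta>2"]) auto
  qed
  have n: "0 < real CARD('n)" by simp
  have forward: "\<exists>\<delta>>0. \<forall>l Q. is_cube l Q \<longrightarrow> l \<le> \<delta> \<longrightarrow> \<bar>set_density A (\<phi> ` Q) - set_density ?B Q\<bar> \<le> \<epsilon>"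
    if \<epsilon>: "0 < \<epsilon>" for \<epsilon>
  proof -
    obtain \<delta> where \<delta>: "0 < \<delta>" "\<And>S. bounded S \<Longrightarrow> S \<in> sets lebesgue \<Longrightarrow> 0 < measure lebesgue S \<Longrightarrow>
      (\<forall>x\<in>S. \<forall>y\<in>S. dist x y < \<delta>) \<Longrightarrow> \<bar>set_density A (\<phi> ` S) - set_density ?B S\<bar> \<le> \<epsilon>"
      using density_image_vimage[OF h assms(2-4) \<epsilon>] by blast
    \<comment> \<open>A cube of side \<open>l\<close> has diameter at most
      \<open>CARD('n) * l\<close>; the factor 2 makes the comparison with \<open>\<delta>\<close>
      strict.\<close>
    define r where "r = \<delta> / (2 * real CARD('n))"
    have r: "0 < r" "real CARD('n) * r < \<delta>" using \<delta>(1) n by (auto simp: r_def)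
    have "\<bar>set_density A (\<phi> ` Q) - set_density ?B Q\<bar> \<le> \<epsilon>" if Q: "is_cube l Q" "l \<le> r" for l Q
    proof (rule \<delta>(2))
      have "real CARD('n) * l \<le> real CARD('n) * r" using Q(2) by (intro mult_left_mono) auto
      then show "\<forall>x\<in>Q. \<forall>y\<in>Q. dist x y < \<delta>" using dist_cube_le[OF Q(1)] r(2) by (meson le_less_trans)
    qed (use cube[OF Q(1)] in auto)
    then show ?thesis using r(1) by blast
  qed
  have backward: "\<exists>\<delta>>0. \<forall>l Q. is_cube l Q \<longrightarrow> l \<le> \<delta> \<longrightarrow> \<bar>set_density ?B (\<psi> ` Q) - set_density A Q\<bar> \<le> \<epsilon>"
    if \<epsilon>: "0 < \<epsilon>" for \<epsilon>
  proof -
    obtain \<delta> where \<delta>: "0 < \<delta>" "\<And>S. bounded S \<Longrightarrow> S \<in> sets lebesgue \<Longrightarrow> 0 < measure lebesgue S \<Longrightarrow>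
      (\<forall>x\<in>S. \<forall>y\<in>S. dist x y < \<delta>) \<Longrightarrow> \<bar>set_density A (\<phi> ` S) - set_density ?B S\<bar> \<le> \<epsilon>"
      using density_image_vimage[OF h assms(2-4) \<epsilon>] by blast
    \<comment> \<open>The additional factor \<open>C\<close> accounts for the growth of diameters
      under \<open>\<psi>\<close>.\<close>
    define r where "r = \<delta> / (2 * (C * real CARD('n)))"
    have r: "0 < r" "C * (real CARD('n) * r) < \<delta>" using \<delta>(1) n C by (auto simp: r_def)
    have "\<bar>set_density ?B (\<psi> ` Q) - set_density A Q\<bar> \<le> \<epsilon>" if Q: "is_cube l Q" "l \<le> r" for l Q
    proof -
      have "dist (\<psi> x) (\<psi> y) < \<delta>" if "x \<in> Q" "y \<in> Q" for x y
      proof -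
        have "dist (\<psi> x) (\<psi> y) \<le> C * dist x y" using lip_g by (simp add: dist_norm)
        also have "\<dots> \<le> C * (real CARD('n) * l)" using dist_cube_le[OF Q(1) that] C by (intro mult_left_mono) auto
        also have "\<dots> \<le> C * (real CARD('n) * r)" using Q(2) C by (intro mult_left_mono) auto
        finally show ?thesis using r(2) by linarith
      qed
      moreover have "measure lebesgue Q \<le> M * measure lebesgue (\<psi> ` Q)"
        using cube[OF Q(1)] by (intro inv.measure_f_ge)
      then have "0 < M * measure lebesgue (\<psi> ` Q)" using cube(4)[OF Q(1)] by linarith
      then have "0 < measure lebesgue (\<psi> ` Q)" using M by (simp add: zero_less_mult_iff)
      ultimately have "\<bar>set_density A (\<phi> ` \<psi> ` Q) - set_density ?B (\<psi> ` Q)\<bar> \<le> \<epsilon>"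
        using cube(2,3)[OF Q(1)] inv.sets_f inv.bounded_f by (intro \<delta>(2)) auto
      then show ?thesis by (simp add: image_image abs_minus_commute)
    qed
    then show ?thesis using r(1) by blast
  qed
  \<comment> \<open>The implications close up in the cycle (a), (c), (b), (a). The last one passes
    through the densities of \<open>?B\<close> in the images of cubes under
    \<open>\<psi>\<close>.\<close>
  have ac: "osc (set_density A) \<Longrightarrow> osc (\<lambda>Q. set_density A (\<phi> ` Q))"
    using image_density_consecutive[OF assms(4)] unfolding osc_def by blast
  have cb: "osc (\<lambda>Q. set_density A (\<phi> ` Q)) \<Longrightarrow> osc (set_density ?B)"
    by (rule transfer[OF forward])
  have "osc (set_density ?B) \<Longrightarrow> osc (\<lambda>Q. set_density ?B (\<psi> ` Q))"
    using inv.image_density_consecutive[OF B] unfolding osc_def by blast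
  then have ba: "osc (set_density ?B) \<Longrightarrow> osc (set_density A)"
    using transfer[OF backward] by blast
  show ?thesis
    unfolding smooth[OF assms(4)] smooth[OF B] smooth_image using ac cb ba by blast
qed

end
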